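(* Let $A,B,C$ be finite sets, $\theta=\{1,\dots,T\}$, and let $\mathfrak{W}=\{(W_t,V_t):t\in\theta\}$ be a compound wiretap channel with $W_t:A\to\mathcal{P}(B)$ and $V_t:A\to\mathcal{P}(C)$. The secrecy capacity of $\mathfrak{W}$ without channel state information is $$C_S(\mathfrak{W})=\lim_{n\to\infty}\frac1n\max_{U\to X^n\to Y_t^nZ_t^n}\Big(\inf_{t\in\theta}I(U;Y_t^n)-\sup_{t\in\theta}I(U;Z_t^n)\Big).$$
   Context: $\mathcal{P}(B)$ is the set of probability distributions on the finite set $B$; a channel $W:A\to\mathcal{P}(B)$ is a stochastic matrix; $W^{\otimes n}$ is its $n$-th memoryless extension. Logarithms are to base 2. Compound wiretap channel: a finite family $\mathfrak{W}=\{(W_t,V_t):t\in\theta\}$, $\theta=\{1,\dots,T\}$, with $W_t:A\to\mathcal{P}(B)$ (to the legitimate receiver) and $V_t:A\to\mathcal{P}(C)$ (to the eavesdropper). An $(n,J_n)$ code (no CSI) consists of a stochastic encoder $E:\mathcal{J}_n\to\mathcal{P}(A^n)$, $\mathcal{J}_n=\{1,\dots,J_n\}$, and mutually disjoint decoding sets $\{D_j\subset B^n:j\in\mathcal{J}_n\}$ (neither depends on $t$). Its maximum error probability is $$e(\mathcal{C}_n)=\max_{t\in\theta}\max_{j\in\mathcal{J}_n}\sum_{x^n\in A^n}E(x^n|j)W_t^{\otimes n}(D_j^c|x^n).$$ A number $R\ge 0$ is an achievable secrecy rate without CSI if there is a sequence of $(n,J_n)$ codes $\mathcal{C}_n$ with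 $\lim_n e(\mathcal{C}_n)=0$, $\liminf_n\frac1n\log J_n\ge R$, and $\lim_n\max_{t\in\theta}I(J;Z_t^n)=0$, where $J$ is uniformly distributed on $\mathcal{J}_n$ and $Z_t^n$ is the resulting output of $V_t^{\otimes n}$, i.e. $\Pr(J=j,Z_t^n=z^n)=\frac1{J_n}\sum_{x^n}E(x^n|j)V_t^{\otimes n}(z^n|x^n)$. $C_S(\mathfrak{W})$ is the largest (supremum) achievable secrecy rate without CSI. The maximum in the formula is over all joint distributions of $(U,X^n)$ with $U$ taking values in some finite set and $X^n$ in $A^n$ (one joint distribution for all $t$), where for each $t\in\theta$, $U\to X^n\to (Y_t^n,Z_t^n)$ is a Markov chain, $Y_t^n$ is the output of $W_t^{\otimes n}$ on input $X^n$ and $Z_t^n$ the output of $V_t^{\otimes n}$ on input $X^n$. *)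

theory Defs
  imports "HOL-Probability.Probability"
begin

text \<open>
  The alphabets are finite types, so a channel from \<open>A\<close> to \<open>\<P>(B)\<close> is a function
  \<open>'a \<Rightarrow> 'b pmf\<close>, and \<open>A\<^sup>n\<close> is the set of lists of length \<open>n\<close>.
\<close>

definition words :: "nat \<Rightarrow> 'a list set" where
  "words n = {xs. length xs = n}"

primrec memoryless_ext :: "('a \<Rightarrow> 'b pmf) \<Rightarrow> 'a list \<Rightarrow> 'b list pmf" where
  "memoryless_ext W [] = return_pmf []"
| "memoryless_ext W (x # xs) =
     map_pmf (\<lambda>(y, ys). y # ys) (pair_pmf (W x) (memoryless_ext W xs))"

lemma pmf_memoryless_ext:
  "length ys = length xs \<Longrightarrow>
     pmf (memoryless_ext W xs) ys = (\<Prod>i<length xs. pmf (W (xs ! i)) (ys ! i))"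
proof (induction xs arbitrary: ys)
  case (Cons x xs)
  then obtain z zs where ys: "ys = z # zs" and len: "length zs = length xs"
    by (cases ys) auto
  have "pmf (memoryless_ext W (x # xs)) (z # zs) = pmf (pair_pmf (W x) (memoryless_ext W xs)) (z, zs)"
    using pmf_map_inj'[of "\<lambda>(y, ys). y # ys" _ "(z, zs)"] by (simp add: inj_on_def)
  then show ?case
    using Cons.IH[OF len] ys by (simp add: pmf_pair prod.lessThan_Suc_shift del: prod.lessThan_Suc)
qed simp

definition mutual_info :: "('u \<times> 'z) pmf \<Rightarrow> real" where
  "mutual_info p =
     prob_space.mutual_information (measure_pmf p) 2 (count_space UNIV) (count_space UNIV) fst snd"

lemma mutual_info_finite:
  fixes p :: "('u::countable \<times> 'z::countable) pmf"
  assumes fin: "finite (set_pmf p)"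
  shows "mutual_info p =
    (\<Sum>(u, z)\<in>set_pmf p. pmf p (u, z) *
       log 2 (pmf p (u, z) / (pmf (map_pmf fst p) u * pmf (map_pmf snd p) z)))"
proof -
  interpret information_space "measure_pmf p" 2
    by unfold_locales auto
  have sf: "sigma_finite_measure (count_space (UNIV :: 'u set))"
    "sigma_finite_measure (count_space (UNIV :: 'z set))"
    by (auto intro: sigma_finite_measure_count_space_countable)
  have prod: "count_space (UNIV :: 'u set) \<Otimes>\<^sub>M count_space (UNIV :: 'z set) = count_space UNIV"
    by (subst pair_measure_countable) auto
  have dist: "distributed (measure_pmf p) (count_space UNIV) f (pmf (map_pmf f p))"
    for f :: "'u \<times> 'z \<Rightarrow> 'c"
    by (simp add: distributed_def map_pmf_rep_eq[symmetric] measure_pmf_eq_density[symmetric])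
  let ?g = "\<lambda>x. pmf p x *
       log 2 (pmf p x / (pmf (map_pmf fst p) (fst x) * pmf (map_pmf snd p) (snd x)))"
  have "mutual_info p = integral\<^sup>L (count_space UNIV \<Otimes>\<^sub>M count_space UNIV) ?g"
    unfolding mutual_info_def
    by (rule mutual_information_distr[OF sf dist _ dist])
       (use dist[of "\<lambda>x. x"] in \<open>simp_all add: prod map_pmf_ident\<close>)
  also have "\<dots> = (\<Sum>x\<in>set_pmf p. ?g x)"
    unfolding prod by (rule lebesgue_integral_count_space_finite_support[THEN trans])
      (auto intro!: sum.mono_neutral_left finite_subset[OF _ fin] simp: fin pmf_eq_0_set_pmf)
  finally show ?thesis
    by (simp add: case_prod_beta)
qed

text \<open>
  For a joint distribution \<open>Q\<close> of \<open>(U, X\<^sup>n)\<close>, the joint distribution of \<open>(U, Z\<^sup>n)\<close> where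
  \<open>U \<rightarrow> X\<^sup>n \<rightarrow> Z\<^sup>n\<close> is a Markov chain and \<open>Z\<^sup>n\<close> is the output of \<open>V\<^sup>\<otimes>\<^sup>n\<close> on input \<open>X\<^sup>n\<close>.
\<close>

definition output_joint :: "('a \<Rightarrow> 'c pmf) \<Rightarrow> ('u \<times> 'a list) pmf \<Rightarrow> ('u \<times> 'c list) pmf" where
  "output_joint V Q =
     bind_pmf Q (\<lambda>(u, xs). map_pmf (\<lambda>zs. (u, zs)) (memoryless_ext V xs))"

definition is_code ::
  "nat \<Rightarrow> nat \<Rightarrow> (nat \<Rightarrow> 'a list pmf) \<Rightarrow> (nat \<Rightarrow> 'b list set) \<Rightarrow> bool" where
  "is_code n J E D \<longleftrightarrow>
     J \<ge> 1 \<and>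
     (\<forall>j\<in>{1..J}. set_pmf (E j) \<subseteq> words n \<and> D j \<subseteq> words n) \<and>
     disjoint_family_on D {1..J}"

definition max_error ::
  "nat \<Rightarrow> (nat \<Rightarrow> 'a::finite \<Rightarrow> 'b pmf) \<Rightarrow> nat \<Rightarrow> nat \<Rightarrow>
   (nat \<Rightarrow> 'a list pmf) \<Rightarrow> (nat \<Rightarrow> 'b list set) \<Rightarrow> real" where
  "max_error T W n J E D =
     (MAX t\<in>{1..T}. MAX j\<in>{1..J}.
        \<Sum>xs\<in>words n. pmf (E j) xs * measure_pmf.prob (memoryless_ext (W t) xs) (words n - D j))"

definition message_input_joint :: "nat \<Rightarrow> (nat \<Rightarrow> 'a list pmf) \<Rightarrow> (nat \<times> 'a list) pmf" where
  "message_input_joint J E =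
     bind_pmf (pmf_of_set {1..J}) (\<lambda>j. map_pmf (\<lambda>xs. (j, xs)) (E j))"

definition leakage ::
  "nat \<Rightarrow> (nat \<Rightarrow> 'a \<Rightarrow> 'c pmf) \<Rightarrow> nat \<Rightarrow> (nat \<Rightarrow> 'a list pmf) \<Rightarrow> real" where
  "leakage T V J E =
     (MAX t\<in>{1..T}. mutual_info (output_joint (V t) (message_input_joint J E)))"

definition achievable_secrecy_rate ::
  "nat \<Rightarrow> (nat \<Rightarrow> 'a::finite \<Rightarrow> 'b pmf) \<Rightarrow> (nat \<Rightarrow> 'a \<Rightarrow> 'c pmf) \<Rightarrow> real \<Rightarrow> bool" where
  "achievable_secrecy_rate T W V R \<longleftrightarrow>
     R \<ge> 0 \<and>
     (\<exists>J E D.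
        (\<forall>n. is_code n (J n) (E n) (D n)) \<and>
        (\<lambda>n. max_error T W n (J n) (E n) (D n)) \<longlonglongrightarrow> 0 \<and>
        liminf (\<lambda>n. ereal (log 2 (real (J n)) / real n)) \<ge> ereal R \<and>
        (\<lambda>n. leakage T V (J n) (E n)) \<longlonglongrightarrow> 0)"

definition secrecy_capacity ::
  "nat \<Rightarrow> (nat \<Rightarrow> 'a::finite \<Rightarrow> 'b pmf) \<Rightarrow> (nat \<Rightarrow> 'a \<Rightarrow> 'c pmf) \<Rightarrow> real" where
  "secrecy_capacity T W V = Sup {R. achievable_secrecy_rate T W V R}"

text \<open>
  Every finite set embeds into the naturals, so letting \<open>U\<close> be a natural number with finite
  support covers all auxiliary variables with values in some finite set.
\<close>

definition auxiliary_input :: "nat \<Rightarrow> (nat \<times> 'a list) pmf \<Rightarrow> bool" where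
  "auxiliary_input n Q \<longleftrightarrow> finite (fst ` set_pmf Q) \<and> snd ` set_pmf Q \<subseteq> words n"

definition secrecy_objective ::
  "nat \<Rightarrow> (nat \<Rightarrow> 'a \<Rightarrow> 'b pmf) \<Rightarrow> (nat \<Rightarrow> 'a \<Rightarrow> 'c pmf) \<Rightarrow> (nat \<times> 'a list) pmf \<Rightarrow> real" where
  "secrecy_objective T W V Q =
     (INF t\<in>{1..T}. mutual_info (output_joint (W t) Q)) -
     (SUP t\<in>{1..T}. mutual_info (output_joint (V t) Q))"

end

(*
  Write M(n) for the maximum over auxiliary inputs of block length n. It suffices to show
  M(n)/n <= C_S for every n >= 1 and liminf M(n)/n >= C_S; no superadditivity of M is needed.

  The maximum is attained because a conic Caratheodory argument bounds the size of the range of U and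
  the objective is continuous on the resulting compact set of joint distributions.

  Converse: the message and the encoder output of a code form an auxiliary input, and Fano's
  inequality bounds its objective below by the rate, up to terms that vanish after dividing by n.

  Achievability: an optimal auxiliary input for block length m defines a wiretap channel on blocks. Draw
  J * L i.i.d. codewords, where l in {1..L} is local randomness. The decoder compares the
  likelihoods of all channel states with the sum of the output distributions, hence does not depend
  on the state. The expected relative entropy between the eavesdropper's output given the message
  and the i.i.d. output is bounded by a moment of the likelihood ratio, which decays exponentially
  when (log L)/k exceeds the eavesdropper's mutual information. As there are only finitely many states,
  one codebook serves them all. Block lengths that are not multiples of m are padded with a constant
  tail, and the data processing inequality shows that this does not increase the leakage.
*)
theory Submission
  imports Defs
begin

abbreviation expect :: "'x pmf \<Rightarrow> ('x \<Rightarrow> real) \<Rightarrow> real" where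
  "expect p f \<equiv> measure_pmf.expectation p f"

text \<open>The leakage in the definition of achievability is not divided by the block length, so a
  bound that is merely o(n) is useless: every error term has to vanish in absolute value. This
  forces exponents that are strictly negative for each state, and the strict gap between rate and
  objective pays for them. Leakage is always measured as relative entropy to one fixed reference,
  the output of the random input before any codebook is chosen. Such a bound holds for each message
  separately, dominates the mutual information whatever messages are kept, and survives
  post-processing. Messages can therefore be discarded and tails appended without a new estimate.
  The rates balance as follows: L takes slightly more than the largest information of the
  eavesdropper, and J * L slightly less than the smallest information of the receiver. Hence the
  infimum minus the supremum, with no matching of states. Logarithms are natural throughout; a
  factor \<open>ln 2\<close> restores base 2. Lists form an infinite type, so finiteness of supports
  is carried as a hypothesis, which makes every expectation a finite sum.\<close>

definition joint :: "'x pmf \<Rightarrow> ('x \<Rightarrow> 'y pmf) \<Rightarrow> ('x \<times> 'y) pmf" where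
  "joint P K = bind_pmf P (\<lambda>x. map_pmf (Pair x) (K x))"

text \<open>Relative entropy in nats. Being real valued, it does not become infinite when
  \<open>q\<close> misses part of the support of \<open>p\<close>; inclusion of supports is
  therefore assumed wherever it matters.\<close>

definition kl :: "'x pmf \<Rightarrow> 'x pmf \<Rightarrow> real" where
  "kl p q = expect p (\<lambda>x. ln (pmf p x / pmf q x))"

subsection \<open>Expectations of finitely supported distributions\<close>

lemma expect_sum:
  "finite (set_pmf p) \<Longrightarrow> expect p f = (\<Sum>x\<in>set_pmf p. pmf p x * f x)"
  by (subst integral_measure_pmf_real[where A = "set_pmf p"]) (auto simp: mult.commute)

lemma expect_sum_superset:
  assumes "finite A" "set_pmf p \<subseteq> A"
  shows "expect p f = (\<Sum>x\<in>A. pmf p x * f x)"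
  using assms by (subst integral_measure_pmf_real[where A = A]) (auto simp: mult.commute)

lemma expect_bind:
  assumes "finite (set_pmf p)" "\<forall>x\<in>set_pmf p. finite (set_pmf (f x))"
  shows "expect (bind_pmf p f) h = expect p (\<lambda>x. expect (f x) h)"
  using assms by (subst pmf_expectation_bind[where A = "set_pmf p"]) (auto simp: expect_sum[of p])

lemma expect_cong:
  assumes "\<And>x. x \<in> set_pmf p \<Longrightarrow> f x = g x"
  shows "expect p f = expect p g"
  using assms by (intro integral_cong_AE) (auto simp: AE_measure_pmf_iff)

lemma expect_mono:
  assumes "finite (set_pmf p)" "\<And>x. x \<in> set_pmf p \<Longrightarrow> f x \<le> g x"
  shows "expect p f \<le> expect p g"
  unfolding expect_sum[OF assms(1)] using assms(2) by (intro sum_mono mult_left_mono) auto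

lemma expect_add:
  "finite (set_pmf p) \<Longrightarrow> expect p (\<lambda>x. f x + g x) = expect p f + expect p g"
  by (simp add: integrable_measure_pmf_finite)

lemma expect_diff:
  "finite (set_pmf p) \<Longrightarrow> expect p (\<lambda>x. f x - g x) = expect p f - expect p g"
  by (simp add: integrable_measure_pmf_finite)

lemma expect_sum_distrib:
  "finite (set_pmf p) \<Longrightarrow> expect p (\<lambda>x. \<Sum>i\<in>I. f i x) = (\<Sum>i\<in>I. expect p (f i))"
  by (simp add: integrable_measure_pmf_finite)

lemma expect_swap:
  assumes "finite (set_pmf p)" "finite (set_pmf q)"
  shows "expect p (\<lambda>x. expect q (f x)) = expect q (\<lambda>y. expect p (\<lambda>x. f x y))"
  unfolding expect_sum[OF assms(1)] expect_sum[OF assms(2)]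
  by (simp add: sum_distrib_left mult_ac sum.swap[of _ "set_pmf q"])

lemma expect_pair:
  assumes "finite (set_pmf p)" "finite (set_pmf q)"
  shows "expect (pair_pmf p q) f = expect p (\<lambda>x. expect q (\<lambda>y. f (x, y)))"
  unfolding pair_pmf_def using assms by (simp add: expect_bind)

text \<open>The probabilistic method: it extracts one codebook from a bound on the average over
  random codebooks.\<close>

lemma exists_le_expect:
  assumes "finite (set_pmf p)"
  shows "\<exists>x\<in>set_pmf p. f x \<le> expect p f"
proof (rule ccontr)
  assume "\<not> ?thesis"
  then have *: "\<And>x. x \<in> set_pmf p \<Longrightarrow> expect p f < f x" by force
  have "(\<Sum>x\<in>set_pmf p. pmf p x * expect p f) < (\<Sum>x\<in>set_pmf p. pmf p x * f x)"
    using assms * by (intro sum_strict_mono mult_strict_left_mono) (auto simp: set_pmf_not_empty pmf_positive_iff)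
  then show False
    using assms expect_sum[of p f] by (simp add: sum_distrib_right[symmetric] sum_pmf_eq_1)
qed

lemma prob_bind:
  assumes "finite (set_pmf p)" "\<forall>x\<in>set_pmf p. finite (set_pmf (f x))"
  shows "measure_pmf.prob (bind_pmf p f) A = expect p (\<lambda>x. measure_pmf.prob (f x) A)"
  using expect_bind[where h = "indicator A", OF assms] by simp

lemma set_joint: "set_pmf (joint P K) = (SIGMA x:set_pmf P. set_pmf (K x))"
  by (auto simp: joint_def)

lemma finite_set_joint:
  assumes "finite (set_pmf P)" "\<forall>x\<in>set_pmf P. finite (set_pmf (K x))"
  shows "finite (set_pmf (joint P K))"
  unfolding set_joint using assms by auto

lemma finite_set_bind:
  assumes "finite (set_pmf P)" "\<forall>x\<in>set_pmf P. finite (set_pmf (K x))"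
  shows "finite (set_pmf (bind_pmf P K))"
  using assms by auto

lemma map_fst_joint: "map_pmf fst (joint P K) = P"
  by (simp add: joint_def map_bind_pmf pmf.map_comp o_def map_pmf_const bind_return_pmf')

lemma map_snd_joint: "map_pmf snd (joint P K) = bind_pmf P K"
  by (simp add: joint_def map_bind_pmf pmf.map_comp o_def)

lemma pmf_joint: "pmf (joint P K) (x, y) = pmf P x * pmf (K x) y"
proof -
  have *: "pmf (map_pmf (Pair x') (K x')) (x, y) = indicator {x} x' * pmf (K x) y" for x'
  proof (cases "x' = x")
    case True
    then show ?thesis by (simp add: pmf_map_inj' inj_on_def)
  next
    case False
    then have "(x, y) \<notin> set_pmf (map_pmf (Pair x') (K x'))" by auto
    with False show ?thesis by (simp add: pmf_eq_0_set_pmf)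
  qed
  show ?thesis
    unfolding joint_def pmf_bind * by (simp add: measure_pmf_single)
qed

lemma expect_joint:
  assumes "finite (set_pmf P)" "\<forall>x\<in>set_pmf P. finite (set_pmf (K x))"
  shows "expect (joint P K) f = expect P (\<lambda>x. expect (K x) (\<lambda>y. f (x, y)))"
  unfolding joint_def using assms by (subst expect_bind) auto

subsection \<open>Relative entropy\<close>

text \<open>A Donsker-Varadhan bound with the logarithm of the moment replaced by its linear
  majorant, so that it follows pointwise from ln x \<le> x - 1. A constant \<open>f\<close> yields
  nonnegativity, a two-valued \<open>f\<close> yields Fano's inequality.\<close>

lemma kl_variational:
  assumes fin: "finite (set_pmf p)" "finite (set_pmf q)" and sub: "set_pmf p \<subseteq> set_pmf q"
    and pos: "\<And>x. f x > 0"
  shows "expect p (\<lambda>x. ln (f x)) - expect q f + 1 \<le> kl p q"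
proof -
  have "expect p (\<lambda>x. ln (f x) - ln (pmf p x / pmf q x))
      \<le> expect p (\<lambda>x. pmf q x * f x / pmf p x - 1)"
  proof (rule expect_mono[OF fin(1)])
    fix x assume x: "x \<in> set_pmf p"
    then have p: "pmf p x > 0" "pmf q x > 0" using sub by (auto simp: pmf_positive_iff)
    have "ln (f x) - ln (pmf p x / pmf q x) = ln (pmf q x * f x / pmf p x)"
      using p pos[of x] by (simp add: ln_div ln_mult)
    also have "\<dots> \<le> pmf q x * f x / pmf p x - 1"
      using p pos[of x] by (intro ln_le_minus_one) auto
    finally show "ln (f x) - ln (pmf p x / pmf q x) \<le> pmf q x * f x / pmf p x - 1" .
  qed
  also have "\<dots> = (\<Sum>x\<in>set_pmf p. pmf q x * f x) - 1"
    unfolding expect_diff[OF fin(1)] expect_sum[OF fin(1), of "\<lambda>x. pmf q x * f x / pmf p x"]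
    by (simp add: pmf_eq_0_set_pmf cong: sum.cong)
  also have "(\<Sum>x\<in>set_pmf p. pmf q x * f x) \<le> (\<Sum>x\<in>set_pmf q. pmf q x * f x)"
    using fin sub pos by (intro sum_mono2) (auto simp: less_imp_le)
  also have "\<dots> = expect q f" using fin by (simp add: expect_sum)
  finally show ?thesis
    unfolding kl_def using expect_diff[OF fin(1)] by simp
qed

lemma kl_nonneg:
  assumes "finite (set_pmf p)" "finite (set_pmf q)" "set_pmf p \<subseteq> set_pmf q"
  shows "0 \<le> kl p q"
  using kl_variational[OF assms, of "\<lambda>_. 1"] by simp

text \<open>On pairs (x, y) the two log ratios differ by at most \<open>f y / r x - 1\<close>. Under
  \<open>joint p G\<close> the mean of \<open>f y / r x\<close> is at most one: dividing by
  \<open>r\<close> turns the weight of \<open>p\<close> into that of \<open>q\<close>, and averaging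
  \<open>f\<close> over the output of \<open>q\<close> returns mass of the output of
  \<open>p\<close>.\<close>

lemma kl_data_processing:
  assumes fin: "finite (set_pmf p)" "finite (set_pmf q)" and sub: "set_pmf p \<subseteq> set_pmf q"
    and finG: "\<forall>x\<in>set_pmf q. finite (set_pmf (G x))"
  shows "kl (bind_pmf p G) (bind_pmf q G) \<le> kl p q"
proof -
  define pG qG where "pG = bind_pmf p G" and "qG = bind_pmf q G"
  define f where "f y = pmf pG y / pmf qG y" for y
  define r where "r x = pmf p x / pmf q x" for x
  have finG': "\<forall>x\<in>set_pmf p. finite (set_pmf (G x))" using finG sub by blast
  have finp: "finite (set_pmf pG)" using fin finG' by (auto simp: pG_def)
  have finq: "finite (set_pmf qG)" using fin finG by (auto simp: qG_def)
  have finj: "finite (set_pmf (joint p G))" by (rule finite_set_joint[OF fin(1) finG'])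
  have "kl pG qG - kl p q = expect (joint p G) (\<lambda>(x, y). ln (f y) - ln (r x))"
    using expect_bind[where h = "\<lambda>y. ln (f y)", OF fin(1) finG']
      expect_diff[OF finj, of "\<lambda>(x, y). ln (f y)" "\<lambda>(x, y). ln (r x)"]
    unfolding case_prod_beta expect_joint[OF fin(1) finG']
    by (simp add: kl_def f_def r_def pG_def)
  also have "\<dots> \<le> expect (joint p G) (\<lambda>(x, y). f y / r x - 1)"
  proof (intro expect_mono finj, clarify)
    fix x y assume "(x, y) \<in> set_pmf (joint p G)"
    then have x: "x \<in> set_pmf p" and y: "y \<in> set_pmf (G x)" by (auto simp: set_joint)
    have "pmf p x > 0" "pmf q x > 0" "pmf pG y > 0" "pmf qG y > 0"
      using x y subsetD[OF sub x] by (auto simp: pG_def qG_def intro!: pmf_positive)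
    then have "ln (f y) - ln (r x) = ln (f y / r x)" "f y / r x > 0"
      by (simp_all add: ln_div ln_mult f_def r_def)
    then show "ln (f y) - ln (r x) \<le> f y / r x - 1"
      using ln_le_minus_one[of "f y / r x"] by simp
  qed
  also have "\<dots> = expect p (\<lambda>x. expect (G x) f / r x) - 1"
    using expect_diff[OF finj, of "\<lambda>(x, y). f y / r x" "\<lambda>_. 1"]
    unfolding case_prod_beta expect_joint[OF fin(1) finG'] by simp
  also have "expect p (\<lambda>x. expect (G x) f / r x) = (\<Sum>x\<in>set_pmf p. pmf q x * expect (G x) f)"
    unfolding expect_sum[OF fin(1)] by (intro sum.cong) (auto simp: pmf_eq_0_set_pmf r_def)
  also have "\<dots> \<le> (\<Sum>x\<in>set_pmf q. pmf q x * expect (G x) f)"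
    using fin sub by (intro sum_mono2 mult_nonneg_nonneg) (auto simp: f_def)
  also have "\<dots> = expect qG f"
    unfolding qG_def using expect_bind[where h = f, OF fin(2) finG] expect_sum[OF fin(2)] by simp
  also have "expect qG f = (\<Sum>y\<in>set_pmf qG. pmf pG y)"
    unfolding expect_sum[OF finq] by (intro sum.cong) (auto simp: pmf_eq_0_set_pmf f_def)
  also have "\<dots> = measure_pmf.prob pG (set_pmf qG)"
    using finq by (simp add: measure_measure_pmf_finite)
  also have "\<dots> \<le> 1" by simp
  finally show ?thesis unfolding pG_def qG_def by simp
qed

subsection \<open>Mutual information\<close>

lemma mutual_info_joint:
  fixes P :: "'u::countable pmf" and K :: "'u \<Rightarrow> 'z::countable pmf"
  assumes fin: "finite (set_pmf P)" "\<forall>x\<in>set_pmf P. finite (set_pmf (K x))"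
  shows "mutual_info (joint P K) * ln 2 =
    expect (joint P K) (\<lambda>(x, z). ln (pmf (K x) z / pmf (bind_pmf P K) z))"
proof -
  have fj: "finite (set_pmf (joint P K))" by (rule finite_set_joint[OF fin])
  show ?thesis
    unfolding mutual_info_finite[OF fj] map_fst_joint map_snd_joint expect_sum[OF fj]
    unfolding sum_distrib_right
    by (intro sum.cong) (auto simp: log_def pmf_joint set_joint pmf_eq_0_set_pmf)
qed

lemma mutual_info_joint_kl:
  fixes P :: "'u::countable pmf" and K :: "'u \<Rightarrow> 'z::countable pmf"
  assumes fin: "finite (set_pmf P)" "\<forall>x\<in>set_pmf P. finite (set_pmf (K x))"
  shows "mutual_info (joint P K) * ln 2 = expect P (\<lambda>x. kl (K x) (bind_pmf P K))"
  by (simp add: mutual_info_joint fin expect_joint kl_def)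

text \<open>The gap between the two sides is the relative entropy between the output distribution
  and \<open>q\<close>.\<close>

lemma mutual_info_le_kl:
  fixes P :: "'u::countable pmf" and K :: "'u \<Rightarrow> 'z::countable pmf"
  assumes fin: "finite (set_pmf P)" "\<forall>x\<in>set_pmf P. finite (set_pmf (K x))"
    and q: "finite (set_pmf q)" "\<And>x. x \<in> set_pmf P \<Longrightarrow> set_pmf (K x) \<subseteq> set_pmf q"
  shows "mutual_info (joint P K) * ln 2 \<le> expect P (\<lambda>x. kl (K x) q)"
proof -
  let ?m = "bind_pmf P K"
  have fj: "finite (set_pmf (joint P K))" by (rule finite_set_joint[OF fin])
  have "expect P (\<lambda>x. kl (K x) q) - mutual_info (joint P K) * ln 2 =
      expect (joint P K) (\<lambda>(x, z). ln (pmf (K x) z / pmf q z) - ln (pmf (K x) z / pmf ?m z))"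
    using expect_diff[OF fj, of "\<lambda>(x, z). ln (pmf (K x) z / pmf q z)"
        "\<lambda>(x, z). ln (pmf (K x) z / pmf ?m z)"]
    unfolding mutual_info_joint_kl[OF fin] kl_def case_prod_beta
    by (simp add: expect_joint[OF fin])
  also have "\<dots> = expect (joint P K) (\<lambda>(x, z). ln (pmf ?m z / pmf q z))"
  proof (intro expect_cong, clarify)
    fix x z assume "(x, z) \<in> set_pmf (joint P K)"
    then have "pmf (K x) z > 0" "pmf q z > 0" "pmf ?m z > 0"
      using q by (auto intro!: pmf_positive simp: set_joint)
    then show "ln (pmf (K x) z / pmf q z) - ln (pmf (K x) z / pmf ?m z) = ln (pmf ?m z / pmf q z)"
      by (simp add: ln_div)
  qed
  also have "\<dots> = kl ?m q" by (simp add: kl_def expect_bind[OF fin] expect_joint[OF fin])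
  also have "\<dots> \<ge> 0" using fin q by (intro kl_nonneg) auto
  finally show ?thesis by simp
qed

subsection \<open>A conic Caratheodory theorem\<close>

text \<open>Gaussian elimination: the unknown \<open>w\<close> is a pivot for equation
  \<open>i\<close> and is eliminated from the others. A solution of the smaller system extends to
  \<open>w\<close> by the value \<open>c\<close> that satisfies equation \<open>i\<close>.\<close>

lemma homogeneous_system_nontrivial:
  fixes v :: "'u \<Rightarrow> 'i \<Rightarrow> real"
  assumes "finite I" "finite S" "card I < card S"
  shows "\<exists>l. (\<exists>u\<in>S. l u \<noteq> 0) \<and> (\<forall>i\<in>I. (\<Sum>u\<in>S. l u * v u i) = 0)"
  using assms
proof (induction I arbitrary: S v rule: finite_induct)
  case empty
  then have "S \<noteq> {}" by auto
  then show ?case by (intro exI[of _ "\<lambda>_. 1"]) auto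
next
  case (insert i I)
  show ?case
  proof (cases "\<forall>u\<in>S. v u i = 0")
    case True
    have "card I < card S" using insert by auto
    from insert.IH[OF insert.prems(1) this, of v] obtain l
      where "\<exists>u\<in>S. l u \<noteq> 0" "\<forall>i\<in>I. (\<Sum>u\<in>S. l u * v u i) = 0" by blast
    then show ?thesis using True by (intro exI[of _ l]) auto
  next
    case False
    then obtain w where w: "w \<in> S" "v w i \<noteq> 0" by blast
    let ?S = "S - {w}"
    have "card I < card ?S" using insert w by auto
    from insert.IH[of ?S "\<lambda>u j. v u j - v u i / v w i * v w j", OF _ this] insert.prems obtain l
      where l: "\<exists>u\<in>?S. l u \<noteq> 0"
        and eq: "\<And>j. j \<in> I \<Longrightarrow> (\<Sum>u\<in>?S. l u * (v u j - v u i / v w i * v w j)) = 0" by auto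
    define c where "c = - (\<Sum>u\<in>?S. l u * v u i) / v w i"
    define l' where "l' = l(w := c)"
    have split: "(\<Sum>u\<in>S. l' u * v u j) = c * v w j + (\<Sum>u\<in>?S. l u * v u j)" for j
      using insert.prems w by (subst sum.remove[of S w]) (auto simp: l'_def intro!: sum.cong)
    have "(\<Sum>u\<in>S. l' u * v u j) = 0" if "j \<in> insert i I" for j
    proof (cases "j = i")
      case True
      then show ?thesis using w by (simp add: split c_def)
    next
      case False
      then have "j \<in> I" using that by simp
      have "0 = (\<Sum>u\<in>?S. l u * v u j) - (\<Sum>u\<in>?S. l u * v u i) / v w i * v w j"
        unfolding eq[OF \<open>j \<in> I\<close>, symmetric]
        by (simp add: right_diff_distrib sum_subtractf sum_distrib_left sum_distrib_right
            sum_divide_distrib mult_ac)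
      then show ?thesis by (simp add: split c_def)
    qed
    moreover have "\<exists>u\<in>S. l' u \<noteq> 0" using l by (auto simp: l'_def)
    ultimately show ?thesis by blast
  qed
qed

text \<open>As long as there are more generators than coordinates, they satisfy a linear relation
  with a positive coefficient. Subtracting a multiple of it keeps all sums and can be tuned to
  remove one generator.\<close>

lemma conic_caratheodory:
  fixes v :: "'u \<Rightarrow> 'i \<Rightarrow> real"
  assumes "finite I" "finite S" "\<And>u. u \<in> S \<Longrightarrow> 0 \<le> w u"
  shows "\<exists>w'. (\<forall>u. 0 \<le> w' u) \<and> {u. w' u \<noteq> 0} \<subseteq> S \<and> card {u. w' u \<noteq> 0} \<le> card I \<and>
    (\<forall>i\<in>I. (\<Sum>u\<in>S. w' u * v u i) = (\<Sum>u\<in>S. w u * v u i))"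
  using assms(2,3)
proof (induction "card S" arbitrary: S w rule: less_induct)
  case less
  show ?case
  proof (cases "card S \<le> card I")
    case True
    let ?w = "\<lambda>u. if u \<in> S then w u else 0"
    have "card {u. ?w u \<noteq> 0} \<le> card S" using less.prems by (intro card_mono) auto
    with True less.prems show ?thesis by (intro exI[of _ ?w]) auto
  next
    case False
    with homogeneous_system_nontrivial[OF assms(1) less.prems(1)] obtain l0
      where l0: "\<exists>u\<in>S. l0 u \<noteq> 0" "\<forall>i\<in>I. (\<Sum>u\<in>S. l0 u * v u i) = 0"
      by (metis not_le)
    obtain l where l: "\<exists>u\<in>S. l u > (0::real)" "\<forall>i\<in>I. (\<Sum>u\<in>S. l u * v u i) = 0"
    proof (cases "\<exists>u\<in>S. l0 u > 0")
      case True
      with l0 that show ?thesis by blast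
    next
      case False
      with l0 have "\<exists>u\<in>S. - l0 u > 0" by force
      moreover have "\<forall>i\<in>I. (\<Sum>u\<in>S. - l0 u * v u i) = 0"
        using l0 by (simp add: sum_negf)
      ultimately show ?thesis by (rule that[of "\<lambda>u. - l0 u"])
    qed
    \<comment> \<open>The largest multiple of the relation that leaves all weights nonnegative; the
      weight of a minimiser \<open>u0\<close> becomes zero, so \<open>u0\<close> leaves
      \<open>S\<close>.\<close>
    define \<theta> where "\<theta> = Min ((\<lambda>u. w u / l u) ` {u\<in>S. l u > 0})"
    have fin: "finite ((\<lambda>u. w u / l u) ` {u\<in>S. l u > 0})" using less.prems by auto
    have "\<theta> \<in> (\<lambda>u. w u / l u) ` {u\<in>S. l u > 0}"
      unfolding \<theta>_def using l fin by (intro Min_in) auto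
    then obtain u0 where u0: "u0 \<in> S" "l u0 > 0" "\<theta> = w u0 / l u0" by auto
    have le: "\<theta> \<le> w u / l u" if "u \<in> S" "l u > 0" for u
      unfolding \<theta>_def using that fin by (intro Min_le) auto
    have \<theta>: "\<theta> \<ge> 0" using u0 less.prems by auto
    define w1 where "w1 u = w u - \<theta> * l u" for u
    have w1: "w1 u \<ge> 0" if "u \<in> S" for u
    proof (cases "l u > 0")
      case True
      with le[OF that True] show ?thesis by (simp add: w1_def field_simps)
    next
      case False
      then have "\<theta> * l u \<le> 0" using \<theta> by (simp add: mult_nonneg_nonpos)
      with less.prems(2)[OF that] show ?thesis by (simp add: w1_def)
    qed
    have z: "w1 u0 = 0" using u0 by (simp add: w1_def)
    have sum1: "(\<Sum>u\<in>S. w1 u * v u i) = (\<Sum>u\<in>S. w u * v u i)" if "i \<in> I" for i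
      using l that by (simp add: w1_def left_diff_distrib sum_subtractf mult.assoc
          sum_distrib_left[symmetric])
    have "card (S - {u0}) < card S" using u0 less.prems by (intro psubset_card_mono) auto
    from less.hyps[OF this, of w1] w1 less.prems obtain w'
      where w': "\<forall>u. 0 \<le> w' u" "{u. w' u \<noteq> 0} \<subseteq> S - {u0}" "card {u. w' u \<noteq> 0} \<le> card I"
        "\<forall>i\<in>I. (\<Sum>u\<in>S - {u0}. w' u * v u i) = (\<Sum>u\<in>S - {u0}. w1 u * v u i)"
      by auto
    have "w' u0 = 0" using w' by auto
    then have "(\<Sum>u\<in>S. w' u * v u i) = (\<Sum>u\<in>S. w u * v u i)" if "i \<in> I" for i
      using w'(4) that sum1[OF that] z u0 less.prems by (simp add: sum.remove[of S u0])
    with w' show ?thesis by (intro exI[of _ w']) auto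
  qed
qed

subsection \<open>Mutual information as a function of the joint input distribution\<close>

definition xlnx :: "real \<Rightarrow> real" where "xlnx x = x * ln x"

lemma xlnx_0 [simp]: "xlnx 0 = 0" by (simp add: xlnx_def)

lemma continuous_on_xlnx: "continuous_on {0..} xlnx"
proof -
  have "continuous (at x within {0..}) xlnx" if "x \<ge> 0" for x
  proof (cases "x = 0")
    case True
    have "(xlnx \<longlongrightarrow> 0) (at_right 0)" unfolding xlnx_def by real_asymp
    with True show ?thesis
      by (simp add: continuous_within at_within_Ici_at_right)
  next
    case False
    then show ?thesis unfolding xlnx_def using that by (intro continuous_intros) auto
  qed
  then show ?thesis by (auto simp: continuous_on_eq_continuous_within)
qed

lemma xlnx_mult:
  assumes "c \<ge> 0" "x \<ge> 0"
  shows "xlnx (c * x) = c * xlnx x + x * xlnx c"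
  using assms by (cases "c = 0"; cases "x = 0") (simp_all add: xlnx_def ln_mult algebra_simps)

text \<open>The mutual information is written without normalising the conditional input distributions:
  \<open>cond_term\<close> is homogeneous of degree one, so a conic combination suffices to shrink the auxiliary
  alphabet.\<close>

definition cond_term :: "('x \<Rightarrow> 'y pmf) \<Rightarrow> 'x set \<Rightarrow> 'y set \<Rightarrow> ('x \<Rightarrow> real) \<Rightarrow> real" where
  "cond_term K X Y a = (\<Sum>y\<in>Y. xlnx (\<Sum>x\<in>X. a x * pmf (K x) y)) - xlnx (\<Sum>x\<in>X. a x)"

definition out_term :: "('x \<Rightarrow> 'y pmf) \<Rightarrow> 'x set \<Rightarrow> 'y set \<Rightarrow> ('x \<Rightarrow> real) \<Rightarrow> real" where
  "out_term K X Y a = (\<Sum>y\<in>Y. xlnx (\<Sum>x\<in>X. a x * pmf (K x) y))"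

text \<open>Output entropy minus conditional entropy: \<open>out_term\<close> is minus the former
  and the sum of the \<open>cond_term\<close> values minus the latter, in nats. The argument is an
  arbitrary weight function rather than a \<open>pmf\<close>, so that continuity can be discussed in
  a function space.\<close>

definition mi_fun ::
  "('x \<Rightarrow> 'y pmf) \<Rightarrow> 'x set \<Rightarrow> 'y set \<Rightarrow> 'u set \<Rightarrow> ('u \<times> 'x \<Rightarrow> real) \<Rightarrow> real" where
  "mi_fun K X Y S q =
     ((\<Sum>u\<in>S. cond_term K X Y (\<lambda>x. q (u, x))) - out_term K X Y (\<lambda>x. \<Sum>u\<in>S. q (u, x))) / ln 2"

text \<open>Scaling the argument of \<open>xlnx\<close> produces an extra term proportional to the
  mass times \<open>xlnx c\<close>. Channel rows sum to one, so the total mass over outputs equals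
  the input mass and the extra terms of the two parts cancel.\<close>

lemma cond_term_scale:
  assumes "finite X" "finite Y" "\<And>x. x \<in> X \<Longrightarrow> set_pmf (K x) \<subseteq> Y"
    and "c \<ge> 0" "\<And>x. x \<in> X \<Longrightarrow> a x \<ge> 0"
  shows "cond_term K X Y (\<lambda>x. c * a x) = c * cond_term K X Y a"
proof -
  have nn: "(\<Sum>x\<in>X. a x * pmf (K x) y) \<ge> 0" for y
    using assms by (intro sum_nonneg mult_nonneg_nonneg) auto
  have "(\<Sum>y\<in>Y. \<Sum>x\<in>X. a x * pmf (K x) y) = (\<Sum>x\<in>X. a x * (\<Sum>y\<in>Y. pmf (K x) y))"
    by (subst sum.swap) (simp add: sum_distrib_left)
  also have "\<dots> = (\<Sum>x\<in>X. a x)"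
    using assms by (intro sum.cong) (auto simp: sum_pmf_eq_1)
  finally have eq: "(\<Sum>y\<in>Y. \<Sum>x\<in>X. a x * pmf (K x) y) = (\<Sum>x\<in>X. a x)" .
  have "(\<Sum>y\<in>Y. xlnx (\<Sum>x\<in>X. c * a x * pmf (K x) y)) =
      (\<Sum>y\<in>Y. c * xlnx (\<Sum>x\<in>X. a x * pmf (K x) y) + (\<Sum>x\<in>X. a x * pmf (K x) y) * xlnx c)"
    using xlnx_mult[OF assms(4) nn] by (simp add: mult.assoc sum_distrib_left[symmetric])
  also have "\<dots> = c * (\<Sum>y\<in>Y. xlnx (\<Sum>x\<in>X. a x * pmf (K x) y)) + (\<Sum>x\<in>X. a x) * xlnx c"
    by (simp add: sum.distrib sum_distrib_left sum_distrib_right[symmetric] eq)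
  finally show ?thesis
    using xlnx_mult[OF assms(4), of "\<Sum>x\<in>X. a x"] assms(5)
    by (simp add: cond_term_def sum_distrib_left[symmetric] sum_nonneg algebra_simps)
qed

lemma pmf_bind_joint_input:
  assumes "finite S" "finite X" "set_pmf Q \<subseteq> S \<times> X"
  shows "pmf (bind_pmf Q (\<lambda>(u, x). map_pmf (Pair u) (K x))) (u, y) = (\<Sum>x\<in>X. pmf Q (u, x) * pmf (K x) y)"
proof -
  have *: "pmf (map_pmf (Pair u') (K x)) (u, y) = (if u' = u then pmf (K x) y else 0)" for u' x
  proof (cases "u' = u")
    case True
    then show ?thesis by (simp add: pmf_map_inj' inj_on_def)
  next
    case False
    then have "(u, y) \<notin> set_pmf (map_pmf (Pair u') (K x))" by auto
    with False show ?thesis by (simp add: pmf_eq_0_set_pmf)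
  qed
  have "pmf (bind_pmf Q (\<lambda>(u, x). map_pmf (Pair u) (K x))) (u, y) =
     (\<Sum>(u', x)\<in>S \<times> X. pmf Q (u', x) * (if u' = u then pmf (K x) y else 0))"
    unfolding pmf_bind using assms
    by (subst expect_sum_superset[of "S \<times> X"]) (auto simp: case_prod_beta * intro!: sum.cong)
  also have "\<dots> = (\<Sum>u'\<in>S. if u' = u then (\<Sum>x\<in>X. pmf Q (u', x) * pmf (K x) y) else 0)"
    unfolding sum.cartesian_product[symmetric] by (intro sum.cong) auto
  also have "\<dots> = (\<Sum>x\<in>X. pmf Q (u, x) * pmf (K x) y)"
  proof (cases "u \<in> S")
    case True
    then show ?thesis using assms by (simp add: sum.delta)
  next
    case False
    then have "pmf Q (u, x) = 0" for x using assms by (auto simp: pmf_eq_0_set_pmf)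
    with False show ?thesis using assms by (simp add: sum.delta)
  qed
  finally show ?thesis .
qed

lemma mutual_info_xlnx:
  fixes p :: "('u::countable \<times> 'z::countable) pmf"
  assumes fin: "finite S" "finite Y" and sub: "set_pmf p \<subseteq> S \<times> Y"
  shows "mutual_info p * ln 2 = (\<Sum>u\<in>S. \<Sum>y\<in>Y. xlnx (pmf p (u, y)))
    - (\<Sum>u\<in>S. xlnx (\<Sum>y\<in>Y. pmf p (u, y))) - (\<Sum>y\<in>Y. xlnx (\<Sum>u\<in>S. pmf p (u, y)))"
proof -
  have finp: "finite (set_pmf p)" using fin sub finite_subset by blast
  have z: "pmf p (u, y) = 0" if "u \<notin> S \<or> y \<notin> Y" for u y
    using that sub by (auto simp: pmf_eq_0_set_pmf)
  have fst: "pmf (map_pmf fst p) u = (\<Sum>y\<in>Y. pmf p (u, y))" for u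
  proof -
    have "pmf (map_pmf fst p) u = measure_pmf.prob p (Pair u ` Y)"
      unfolding pmf_map using sub by (intro measure_prob_cong_0) (auto simp: pmf_eq_0_set_pmf)
    also have "\<dots> = (\<Sum>y\<in>Y. pmf p (u, y))"
      using fin by (subst measure_measure_pmf_finite) (auto simp: sum.reindex inj_on_def)
    finally show ?thesis .
  qed
  have snd: "pmf (map_pmf snd p) y = (\<Sum>u\<in>S. pmf p (u, y))" for y
  proof -
    have "pmf (map_pmf snd p) y = measure_pmf.prob p ((\<lambda>u. (u, y)) ` S)"
      unfolding pmf_map using sub by (intro measure_prob_cong_0) (auto simp: pmf_eq_0_set_pmf)
    also have "\<dots> = (\<Sum>u\<in>S. pmf p (u, y))"
      using fin by (subst measure_measure_pmf_finite) (auto simp: sum.reindex inj_on_def)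
    finally show ?thesis .
  qed
  let ?a = "\<lambda>u. \<Sum>y\<in>Y. pmf p (u, y)" and ?b = "\<lambda>y. \<Sum>u\<in>S. pmf p (u, y)"
  have "mutual_info p * ln 2 = (\<Sum>(u, y)\<in>set_pmf p. pmf p (u, y) * ln (pmf p (u, y) / (?a u * ?b y)))"
    unfolding mutual_info_finite[OF finp] fst snd sum_distrib_right
    by (intro sum.cong) (auto simp: log_def)
  also have "\<dots> = (\<Sum>(u, y)\<in>S \<times> Y. pmf p (u, y) * ln (pmf p (u, y) / (?a u * ?b y)))"
    using sub fin by (intro sum.mono_neutral_left) (auto simp: pmf_eq_0_set_pmf)
  also have "\<dots> = (\<Sum>(u, y)\<in>S \<times> Y. xlnx (pmf p (u, y)) - pmf p (u, y) * ln (?a u) - pmf p (u, y) * ln (?b y))"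
  proof (intro sum.cong refl, clarify)
    fix u y assume uy: "u \<in> S" "y \<in> Y"
    show "pmf p (u, y) * ln (pmf p (u, y) / (?a u * ?b y)) =
      xlnx (pmf p (u, y)) - pmf p (u, y) * ln (?a u) - pmf p (u, y) * ln (?b y)"
    proof (cases "pmf p (u, y) = 0")
      case False
      then have pos: "pmf p (u, y) > 0" by (simp add: pmf_positive_iff pmf_eq_0_set_pmf)
      have "pmf p (u, y) \<le> ?a u" using uy fin by (intro member_le_sum) auto
      moreover have "pmf p (u, y) \<le> ?b y"
        using uy fin by (intro member_le_sum[of u S "\<lambda>u. pmf p (u, y)"]) auto
      ultimately have "?a u > 0" "?b y > 0" using pos by linarith+
      then show ?thesis using pos by (simp add: ln_div ln_mult xlnx_def algebra_simps)
    qed simp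
  qed
  also have "\<dots> = (\<Sum>u\<in>S. \<Sum>y\<in>Y. xlnx (pmf p (u, y))) - (\<Sum>u\<in>S. \<Sum>y\<in>Y. pmf p (u, y) * ln (?a u))
      - (\<Sum>u\<in>S. \<Sum>y\<in>Y. pmf p (u, y) * ln (?b y))"
    unfolding sum.cartesian_product[symmetric] by (simp add: sum_subtractf)
  also have "(\<Sum>u\<in>S. \<Sum>y\<in>Y. pmf p (u, y) * ln (?b y)) = (\<Sum>y\<in>Y. xlnx (?b y))"
    by (subst sum.swap) (simp add: sum_distrib_right[symmetric] xlnx_def)
  finally show ?thesis by (simp add: sum_distrib_right[symmetric] xlnx_def)
qed

lemma mutual_info_mi_fun:
  fixes Q :: "('u::countable \<times> 'x) pmf" and K :: "'x \<Rightarrow> 'y::countable pmf"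
  assumes fin: "finite S" "finite X" "finite Y" and sub: "set_pmf Q \<subseteq> S \<times> X"
    and K: "\<And>x. x \<in> X \<Longrightarrow> set_pmf (K x) \<subseteq> Y"
  shows "mutual_info (bind_pmf Q (\<lambda>(u, x). map_pmf (Pair u) (K x))) = mi_fun K X Y S (pmf Q)"
proof -
  let ?p = "bind_pmf Q (\<lambda>(u, x). map_pmf (Pair u) (K x))"
  have sub': "set_pmf ?p \<subseteq> S \<times> Y" using sub K by fastforce
  have a: "(\<Sum>y\<in>Y. pmf ?p (u, y)) = (\<Sum>x\<in>X. pmf Q (u, x))" for u
  proof -
    have "(\<Sum>y\<in>Y. pmf ?p (u, y)) = (\<Sum>x\<in>X. pmf Q (u, x) * (\<Sum>y\<in>Y. pmf (K x) y))"
      unfolding pmf_bind_joint_input[OF fin(1,2) sub] by (subst sum.swap) (simp add: sum_distrib_left)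
    also have "\<dots> = (\<Sum>x\<in>X. pmf Q (u, x))"
      using fin K by (intro sum.cong) (auto simp: sum_pmf_eq_1)
    finally show ?thesis .
  qed
  have b: "(\<Sum>u\<in>S. pmf ?p (u, y)) = (\<Sum>x\<in>X. (\<Sum>u\<in>S. pmf Q (u, x)) * pmf (K x) y)" for y
    unfolding pmf_bind_joint_input[OF fin(1,2) sub] by (subst sum.swap) (simp add: sum_distrib_right)
  have "mutual_info ?p * ln 2 = mi_fun K X Y S (pmf Q) * ln 2"
    unfolding mutual_info_xlnx[OF fin(1,3) sub'] a b mi_fun_def cond_term_def out_term_def
    by (simp add: pmf_bind_joint_input[OF fin(1,2) sub] sum_subtractf)
  then show ?thesis by simp
qed

lemma continuous_on_xlnx_compose:
  assumes "continuous_on C f" "\<And>q. q \<in> C \<Longrightarrow> 0 \<le> f q"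
  shows "continuous_on C (\<lambda>q. xlnx (f q))"
  using continuous_on_compose2[OF continuous_on_xlnx assms(1)] assms(2) by auto

lemma continuous_on_coord: "continuous_on C (\<lambda>q :: 'i \<Rightarrow> real. q i)"
  by (rule continuous_on_subset[OF continuous_on_product_coordinates]) simp

lemma continuous_on_mi_fun:
  assumes "\<And>q p. q \<in> C \<Longrightarrow> 0 \<le> q p"
  shows "continuous_on C (mi_fun K X Y S)"
  unfolding mi_fun_def cond_term_def out_term_def using assms
  by (intro continuous_intros continuous_on_xlnx_compose continuous_on_coord)
    (auto intro!: sum_nonneg mult_nonneg_nonneg)

lemma continuous_on_INF_finite:
  fixes f :: "'i \<Rightarrow> 'q::topological_space \<Rightarrow> real"
  assumes "finite I" "I \<noteq> {}" "\<And>i. i \<in> I \<Longrightarrow> continuous_on C (f i)"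
  shows "continuous_on C (\<lambda>q. INF i\<in>I. f i q)"
  using assms
proof (induction I rule: finite_ne_induct)
  case (insert i I)
  have "(INF i\<in>insert i I. f i q) = min (f i q) (INF i\<in>I. f i q)" for q
    using insert by (subst cINF_insert) (auto simp: inf_min)
  then show ?case using insert by (auto intro!: continuous_on_min)
qed auto

lemma continuous_on_SUP_finite:
  fixes f :: "'i \<Rightarrow> 'q::topological_space \<Rightarrow> real"
  assumes "finite I" "I \<noteq> {}" "\<And>i. i \<in> I \<Longrightarrow> continuous_on C (f i)"
  shows "continuous_on C (\<lambda>q. SUP i\<in>I. f i q)"
  using assms
proof (induction I rule: finite_ne_induct)
  case (insert i I)
  have "(SUP i\<in>insert i I. f i q) = max (f i q) (SUP i\<in>I. f i q)" for q
    using insert by (subst cSUP_insert) (auto simp: sup_max)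
  then show ?case using insert by (auto intro!: continuous_on_max)
qed auto

subsection \<open>Existence of an optimal auxiliary input\<close>

lemma finite_words: "finite (words n :: 'a::finite list set)"
  using finite_lists_length_eq[of "UNIV :: 'a set" n] by (simp add: words_def)

lemma set_memoryless_ext_words: "set_pmf (memoryless_ext W xs) \<subseteq> words (length xs)"
  by (induction xs) (auto simp: words_def)

definition objective_fun ::
  "nat \<Rightarrow> (nat \<Rightarrow> 'a \<Rightarrow> 'b pmf) \<Rightarrow> (nat \<Rightarrow> 'a \<Rightarrow> 'c pmf) \<Rightarrow> nat \<Rightarrow>
   'u set \<Rightarrow> ('u \<times> 'a list \<Rightarrow> real) \<Rightarrow> real" where
  "objective_fun T W V n S q =
     (INF t\<in>{1..T}. mi_fun (memoryless_ext (W t)) (words n) (words n) S q) -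
     (SUP t\<in>{1..T}. mi_fun (memoryless_ext (V t)) (words n) (words n) S q)"

lemma secrecy_objective_fun:
  fixes W :: "nat \<Rightarrow> 'a::finite \<Rightarrow> 'b::finite pmf" and V :: "nat \<Rightarrow> 'a \<Rightarrow> 'c::finite pmf"
  assumes "finite S" "set_pmf Q \<subseteq> S \<times> words n"
  shows "secrecy_objective T W V Q = objective_fun T W V n S (pmf Q)"
proof -
  have sub: "set_pmf (memoryless_ext K xs) \<subseteq> words n" if "xs \<in> words n"
    for K :: "'a \<Rightarrow> 'z pmf" and xs
    using set_memoryless_ext_words[of K xs] that by (simp add: words_def)
  show ?thesis
    unfolding secrecy_objective_def objective_fun_def output_joint_def
    using assms by (simp add: mutual_info_mi_fun[OF _ finite_words finite_words _ sub])
qed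

lemma mi_fun_cong:
  assumes "finite S" "finite S'"
    and "(\<Sum>u\<in>S. cond_term K X Y (\<lambda>x. q (u, x))) = (\<Sum>u\<in>S'. cond_term K X Y (\<lambda>x. q' (u, x)))"
    and "\<And>x. x \<in> X \<Longrightarrow> (\<Sum>u\<in>S. q (u, x)) = (\<Sum>u\<in>S'. q' (u, x))"
  shows "mi_fun K X Y S q = mi_fun K X Y S' q'"
  using assms unfolding mi_fun_def out_term_def by (simp cong: sum.cong)

text \<open>The probability simplex over \<open>A\<close>, extended by zero. Forcing the other
  coordinates to vanish makes it a closed part of a product of compact factors, so Tychonoff's
  theorem applies although the index type may be infinite.\<close>

definition input_weights :: "('u \<times> 'x) set \<Rightarrow> ('u \<times> 'x \<Rightarrow> real) set" where
  "input_weights A = {q. (\<forall>p. q p \<in> (if p \<in> A then {0..1} else {0})) \<and> (\<Sum>p\<in>A. q p) = 1}"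

lemma compact_input_weights:
  shows "compact (input_weights A)"
proof -
  let ?I = "\<lambda>p. if p \<in> A then {0..1::real} else {0}"
  have "compactin (product_topology (\<lambda>_. euclidean) UNIV) (PiE UNIV ?I)"
    by (subst compactin_PiE) auto
  then have "compact (PiE UNIV ?I)"
    by (simp add: euclidean_product_topology)
  moreover have "closed {q :: 'a \<times> 'b \<Rightarrow> real. (\<Sum>p\<in>A. q p) = 1}"
    by (intro closed_Collect_eq continuous_intros) simp
  ultimately have "compact (PiE UNIV ?I \<inter> {q. (\<Sum>p\<in>A. q p) = 1})"
    by (rule compact_Int_closed)
  also have "PiE UNIV ?I \<inter> {q. (\<Sum>p\<in>A. q p) = 1} = input_weights A"
    by (auto simp: input_weights_def PiE_def Pi_def)
  finally show ?thesis .
qed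

lemma input_weights_range:
  assumes "q \<in> input_weights A"
  shows "0 \<le> q p" "p \<notin> A \<Longrightarrow> q p = 0"
proof -
  have "q p \<in> (if p \<in> A then {0..1} else {0})" using assms unfolding input_weights_def by blast
  then show "0 \<le> q p" "p \<notin> A \<Longrightarrow> q p = 0" by (auto split: if_splits)
qed

lemma input_weights_pmf:
  assumes "finite A" "q \<in> input_weights A"
  shows "\<exists>Q. pmf Q = q \<and> set_pmf Q \<subseteq> A"
proof -
  note nn = input_weights_range(1)[OF assms(2)] and z = input_weights_range(2)[OF assms(2)]
  have "(\<integral>\<^sup>+ p. ennreal (q p) \<partial>count_space UNIV) = (\<Sum>p\<in>A. ennreal (q p))"
    using assms z by (intro nn_integral_count_space') auto
  also have "\<dots> = 1" using assms nn by (simp add: sum_ennreal input_weights_def)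
  finally have "pmf (embed_pmf q) p = q p" for p using nn by (intro pmf_embed_pmf)
  then have "pmf (embed_pmf q) = q" by auto
  moreover then have "set_pmf (embed_pmf q) \<subseteq> A" using z by (metis pmf_eq_0_set_pmf subsetI)
  ultimately show ?thesis by blast
qed

lemma cond_term_words_scale:
  fixes K :: "'a::finite \<Rightarrow> 'b::finite pmf"
  assumes "c \<ge> 0" "\<And>x. x \<in> words n \<Longrightarrow> a x = c * a' x" "\<And>x. x \<in> words n \<Longrightarrow> a' x \<ge> 0"
  shows "cond_term (memoryless_ext K) (words n) (words n) a =
    c * cond_term (memoryless_ext K) (words n) (words n) a'"
proof -
  have sub: "set_pmf (memoryless_ext K xs) \<subseteq> words n" if "xs \<in> words n" for xs
    using set_memoryless_ext_words[of K xs] that by (simp add: words_def)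
  have "cond_term (memoryless_ext K) (words n) (words n) a =
      cond_term (memoryless_ext K) (words n) (words n) (\<lambda>x. c * a' x)"
    unfolding cond_term_def using assms by (simp cong: sum.cong)
  also have "\<dots> = c * cond_term (memoryless_ext K) (words n) (words n) a'"
    by (rule cond_term_scale[OF finite_words finite_words sub assms(1,3)])
  finally show ?thesis .
qed

text \<open>Each value u contributes a vector with T + T coordinates for the conditional terms of
  all channels and one coordinate per input word; \<open>N\<close> counts them. A reweighting that
  keeps the sum of these vectors keeps all conditional entropies and the input marginal, hence also
  the output entropies and the total mass.\<close>

lemma bounded_auxiliary_alphabet:
  fixes W :: "nat \<Rightarrow> 'a::finite \<Rightarrow> 'b::finite pmf" and V :: "nat \<Rightarrow> 'a \<Rightarrow> 'c::finite pmf"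
    and n T :: nat
  defines "N \<equiv> T + T + card (words n :: 'a list set)"
  assumes "auxiliary_input n Q"
  shows "\<exists>q \<in> input_weights ({..<N} \<times> words n).
    objective_fun T W V n {..<N} q = secrecy_objective T W V Q"
proof -
  define X :: "'a list set" where "X = words n"
  define S where "S = fst ` set_pmf Q"
  have finS: "finite S" and sub: "set_pmf Q \<subseteq> S \<times> X"
    using assms(2) by (auto simp: auxiliary_input_def S_def X_def image_subset_iff intro: rev_image_eqI)
  have finX: "finite X" by (simp add: X_def finite_words)
  define gW where "gW t u = cond_term (memoryless_ext (W t)) X (words n) (\<lambda>x. pmf Q (u, x))" for t u
  define gV where "gV t u = cond_term (memoryless_ext (V t)) X (words n) (\<lambda>x. pmf Q (u, x))" for t u
  define I :: "((nat + nat) + 'a list) set" where "I = ({1..T} <+> {1..T}) <+> X"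
  define v where "v u i = (case i of Inr x \<Rightarrow> pmf Q (u, x) | Inl (Inl t) \<Rightarrow> gW t u | Inl (Inr t) \<Rightarrow> gV t u)"
    for u and i :: "(nat + nat) + 'a list"
  have finI: "finite I" and cardI: "card I = N"
    using finX by (simp_all add: I_def N_def X_def card_Plus)
  from conic_caratheodory[OF finI finS, of "\<lambda>_. 1" v] obtain w
    where w: "\<forall>u. 0 \<le> w u" "{u. w u \<noteq> 0} \<subseteq> S" "card {u. w u \<noteq> 0} \<le> N"
      "\<forall>i\<in>I. (\<Sum>u\<in>S. w u * v u i) = (\<Sum>u\<in>S. 1 * v u i)" unfolding cardI by auto
  define S' where "S' = {u. w u \<noteq> 0}"
  have finS': "finite S'" using w finS finite_subset by (auto simp: S'_def)
  \<comment> \<open>\<open>h\<close> renumbers the surviving values as an initial segment of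
    \<open>{..<N}\<close>; the remaining indices receive zero rows.\<close>
  from ex_bij_betw_nat_finite[OF finS'] obtain h where h: "bij_betw h {0..<card S'} S'" by blast
  define q where "q = (\<lambda>(i, x). if i < card S' \<and> x \<in> X then w (h i) * pmf Q (h i, x) else 0)"
  have cS': "card S' \<le> N" using w by (simp add: S'_def)
  have transfer: "(\<Sum>i<N. f (\<lambda>x. q (i, x))) = (\<Sum>u\<in>S. w u * f (\<lambda>x. pmf Q (u, x)))"
    if f: "\<And>c a a'. c \<ge> 0 \<Longrightarrow> (\<And>x. x \<in> X \<Longrightarrow> a x = c * a' x) \<Longrightarrow> (\<And>x. x \<in> X \<Longrightarrow> a' x \<ge> 0) \<Longrightarrow> f a = c * f a'"
    for f :: "('a list \<Rightarrow> real) \<Rightarrow> real"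
  proof -
    have "(\<Sum>i<N. f (\<lambda>x. q (i, x))) = (\<Sum>i\<in>{0..<card S'}. f (\<lambda>x. q (i, x)))"
    proof (intro sum.mono_neutral_right ballI)
      fix i assume "i \<in> {..<N} - {0..<card S'}"
      then have "\<And>x. q (i, x) = 0 * 0" by (simp add: q_def)
      from f[of 0 "\<lambda>x. q (i, x)" "\<lambda>_. 0", OF _ this] show "f (\<lambda>x. q (i, x)) = 0" by simp
    qed (use cS' in auto)
    also have "\<dots> = (\<Sum>i\<in>{0..<card S'}. w (h i) * f (\<lambda>x. pmf Q (h i, x)))"
    proof (rule sum.cong[OF refl])
      fix i assume "i \<in> {0..<card S'}"
      then show "f (\<lambda>x. q (i, x)) = w (h i) * f (\<lambda>x. pmf Q (h i, x))"
        using w(1) by (intro f) (auto simp: q_def)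
    qed
    also have "\<dots> = (\<Sum>u\<in>S'. w u * f (\<lambda>x. pmf Q (u, x)))"
      by (rule sum.reindex_bij_betw[OF h])
    also have "\<dots> = (\<Sum>u\<in>S. w u * f (\<lambda>x. pmf Q (u, x)))"
      using w finS by (intro sum.mono_neutral_left) (auto simp: S'_def)
    finally show ?thesis .
  qed
  have marg: "(\<Sum>i<N. q (i, x)) = (\<Sum>u\<in>S. pmf Q (u, x))" if "x \<in> X" for x
  proof -
    have "Inr x \<in> I" using that by (auto simp: I_def)
    with w(4) transfer[of "\<lambda>a. a x"] that show ?thesis by (auto simp: v_def)
  qed
  have tW: "mi_fun (memoryless_ext (W t)) X (words n) {..<N} q = mi_fun (memoryless_ext (W t)) X (words n) S (pmf Q)"
    if "t \<in> {1..T}" for t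
  proof -
    have "Inl (Inl t) \<in> I" using that by (auto simp: I_def)
    with w(4) have "(\<Sum>u\<in>S. w u * gW t u) = (\<Sum>u\<in>S. gW t u)" by (auto simp: v_def)
    moreover have "(\<Sum>i<N. cond_term (memoryless_ext (W t)) X (words n) (\<lambda>x. q (i, x))) = (\<Sum>u\<in>S. w u * gW t u)"
      unfolding gW_def X_def
      by (rule transfer[of "cond_term (memoryless_ext (W t)) (words n) (words n)"])
        (rule cond_term_words_scale, auto simp: X_def)
    ultimately show ?thesis
      using finS marg by (intro mi_fun_cong) (auto simp: gW_def)
  qed
  have tV: "mi_fun (memoryless_ext (V t)) X (words n) {..<N} q = mi_fun (memoryless_ext (V t)) X (words n) S (pmf Q)"
    if "t \<in> {1..T}" for t
  proof -
    have "Inl (Inr t) \<in> I" using that by (auto simp: I_def)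
    with w(4) have "(\<Sum>u\<in>S. w u * gV t u) = (\<Sum>u\<in>S. gV t u)" by (auto simp: v_def)
    moreover have "(\<Sum>i<N. cond_term (memoryless_ext (V t)) X (words n) (\<lambda>x. q (i, x))) = (\<Sum>u\<in>S. w u * gV t u)"
      unfolding gV_def X_def
      by (rule transfer[of "cond_term (memoryless_ext (V t)) (words n) (words n)"])
        (rule cond_term_words_scale, auto simp: X_def)
    ultimately show ?thesis
      using finS marg by (intro mi_fun_cong) (auto simp: gV_def)
  qed
  have "objective_fun T W V n {..<N} q = objective_fun T W V n S (pmf Q)"
    unfolding objective_fun_def X_def[symmetric] 
    by (intro arg_cong2[where f = "(-)"] INF_cong SUP_cong refl tW tV)
  also have "\<dots> = secrecy_objective T W V Q"
    using finS sub by (simp add: secrecy_objective_fun X_def)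
  finally have obj: "objective_fun T W V n {..<N} q = secrecy_objective T W V Q" .
  have nn: "q p \<ge> 0" for p using w by (auto simp: q_def split: prod.splits)
  have "(\<Sum>p\<in>{..<N} \<times> X. q p) = (\<Sum>x\<in>X. \<Sum>i<N. q (i, x))"
    by (subst sum.swap) (simp only: sum.cartesian_product case_prod_eta)
  also have "\<dots> = (\<Sum>u\<in>S. \<Sum>x\<in>X. pmf Q (u, x))"
    using marg by (subst (2) sum.swap) (rule sum.cong, simp_all)
  also have "\<dots> = 1"
    unfolding sum.cartesian_product case_prod_eta
    by (rule sum_pmf_eq_1) (use sub finS finX in auto)
  finally have one: "(\<Sum>p\<in>{..<N} \<times> X. q p) = 1" .
  have "q p \<le> 1" if "p \<in> {..<N} \<times> X" for p
    using member_le_sum[of p "{..<N} \<times> X" q] that nn finX one by simp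
  moreover have "q p = 0" if "p \<notin> {..<N} \<times> X" for p
    using that cS' by (auto simp: q_def split: prod.splits)
  ultimately have "q \<in> input_weights ({..<N} \<times> X)"
    using nn one by (auto simp: input_weights_def)
  with obj show ?thesis by (auto simp: X_def)
qed

lemma arg_max_auxiliary_input:
  fixes W :: "nat \<Rightarrow> 'a::finite \<Rightarrow> 'b::finite pmf" and V :: "nat \<Rightarrow> 'a \<Rightarrow> 'c::finite pmf"
  assumes "T \<ge> 1"
  shows "\<exists>Q. is_arg_max (secrecy_objective T W V) (auxiliary_input n) Q"
proof -
  define N where "N = T + T + card (words n :: 'a list set)"
  define A :: "(nat \<times> 'a list) set" where "A = {..<N} \<times> words n"
  have finA: "finite A" by (simp add: A_def finite_words)
  have aux: "auxiliary_input n (return_pmf (0, replicate n undefined) :: (nat \<times> 'a list) pmf)"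
    by (simp add: auxiliary_input_def words_def)
  have ne: "input_weights A \<noteq> {}"
    using bounded_auxiliary_alphabet[OF aux] by (auto simp: A_def N_def)
  note nn = input_weights_range(1)
  have "continuous_on (input_weights A) (objective_fun T W V n {..<N})"
    unfolding objective_fun_def using assms nn
    by (intro continuous_intros continuous_on_INF_finite continuous_on_SUP_finite continuous_on_mi_fun) auto
  from continuous_attains_sup[OF compact_input_weights ne this] obtain q
    where q: "q \<in> input_weights A"
      "\<And>q'. q' \<in> input_weights A \<Longrightarrow> objective_fun T W V n {..<N} q' \<le> objective_fun T W V n {..<N} q"
    by blast
  from input_weights_pmf[OF finA q(1)] obtain Q where Q: "pmf Q = q" "set_pmf Q \<subseteq> A" by blast
  have "auxiliary_input n Q"
  proof -
    have "fst ` set_pmf Q \<subseteq> {..<N}" using Q(2) by (auto simp: A_def)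
    then have "finite (fst ` set_pmf Q)" by (rule finite_subset) simp
    then show ?thesis using Q(2) by (auto simp: auxiliary_input_def A_def)
  qed
  moreover have "secrecy_objective T W V Q' \<le> secrecy_objective T W V Q" if aux': "auxiliary_input n Q'" for Q'
  proof -
    obtain q' where q': "q' \<in> input_weights A" "objective_fun T W V n {..<N} q' = secrecy_objective T W V Q'"
      using bounded_auxiliary_alphabet[OF aux', of T W V] unfolding A_def N_def by blast
    have "secrecy_objective T W V Q = objective_fun T W V n {..<N} q"
      unfolding Q(1)[symmetric] using Q(2) by (intro secrecy_objective_fun) (auto simp: A_def)
    with q(2)[OF q'(1)] q'(2) show ?thesis by simp
  qed
  ultimately show ?thesis unfolding is_arg_max_linorder by blast
qed

subsection \<open>Random codebooks\<close>

definition codebook :: "'i set \<Rightarrow> 'x pmf \<Rightarrow> ('i \<Rightarrow> 'x) pmf" where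
  "codebook I P = Pi_pmf I undefined (\<lambda>_. P)"

lemma finite_set_codebook:
  "finite I \<Longrightarrow> finite (set_pmf P) \<Longrightarrow> finite (set_pmf (codebook I P))"
  by (auto simp: codebook_def set_Pi_pmf)

lemma codebook_in_set: "finite I \<Longrightarrow> c \<in> set_pmf (codebook I P) \<Longrightarrow> i \<in> I \<Longrightarrow> c i \<in> set_pmf P"
  by (auto simp: codebook_def set_Pi_pmf PiE_dflt_def)

lemma expect_codebook:
  assumes "finite I" "i \<in> I"
  shows "expect (codebook I P) (\<lambda>c. g (c i)) = expect P g"
proof -
  have "expect P g = expect (map_pmf (\<lambda>c. c i) (codebook I P)) g"
    using assms by (simp add: codebook_def Pi_pmf_component del: integral_map_pmf)
  then show ?thesis by simp
qed

lemma expect_codebook2: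
  assumes "finite I" "i \<in> I" "i' \<in> I" "i \<noteq> i'" "finite (set_pmf P)"
  shows "expect (codebook I P) (\<lambda>c. g (c i) (c i')) = expect P (\<lambda>x. expect P (g x))"
proof -
  let ?I = "I - {i}"
  have I: "I = insert i ?I" using assms by auto
  have fin: "finite ?I" using assms by auto
  have "codebook I P = map_pmf (\<lambda>(y, f). f(i := y)) (pair_pmf P (codebook ?I P))"
    unfolding codebook_def using Pi_pmf_insert[OF fin, of i undefined "\<lambda>_. P"] I by simp
  then have "expect (codebook I P) (\<lambda>c. g (c i) (c i')) =
      expect (pair_pmf P (codebook ?I P)) (\<lambda>p. g (fst p) (snd p i'))"
    using assms(4) by (simp add: case_prod_beta)
  also have "\<dots> = expect P (\<lambda>y. expect (codebook ?I P) (\<lambda>f. g y (f i')))"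
    using expect_pair[OF assms(5) finite_set_codebook[OF fin assms(5)],
        of "\<lambda>p. g (fst p) (snd p i')"] by simp
  also have "\<dots> = expect P (\<lambda>x. expect P (g x))"
    using assms by (simp add: expect_codebook[OF fin])
  finally show ?thesis .
qed

lemma expect_uniform:
  assumes "L \<ge> (1::nat)"
  shows "expect (pmf_of_set {1..L}) f = (\<Sum>l\<in>{1..L}. f l) / real L"
  using assms by (subst integral_pmf_of_set) auto

text \<open>Only pairwise independence of the codewords enters: the logarithm of the output density is bounded
  by its tangent at \<open>1 + V(z|x) / (L r(z))\<close>, which exceeds the conditional mean given the transmitted
  codeword \<open>x\<close> by \<open>1 / L\<close>, and the tangent is linear in the remaining codewords.\<close>

lemma soft_covering:
  fixes P :: "'x pmf" and V :: "'x \<Rightarrow> 'z pmf" and e :: "nat \<Rightarrow> 'i"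
  assumes finP: "finite (set_pmf P)" and finV: "\<forall>x\<in>set_pmf P. finite (set_pmf (V x))"
    and I: "finite I" and e: "inj_on e {1..L}" "e ` {1..L} \<subseteq> I" and L: "L \<ge> (1::nat)"
  defines "r \<equiv> bind_pmf P V"
  shows "expect (codebook I P) (\<lambda>c. kl (bind_pmf (pmf_of_set {1..L}) (\<lambda>l. V (c (e l)))) r)
    \<le> expect (joint P V) (\<lambda>(x, z). ln (1 + pmf (V x) z / (real L * pmf r z)))"
proof -
  let ?C = "codebook I P"
  have finC: "finite (set_pmf ?C)" by (rule finite_set_codebook[OF I finP])
  define w0 where "w0 x z = 1 + pmf (V x) z / (real L * pmf r z)" for x z
  have w0: "w0 x z \<ge> 1" for x z by (simp add: w0_def)
  \<comment> \<open>The pieces of the tangent bound: \<open>g1\<close> is the value of the logarithm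
    at the point of tangency, \<open>g2\<close> the linear contribution of another codeword
    \<open>x'\<close> up to the factor 1 / L, and \<open>g3\<close> the amount subtracted.\<close>
  define g1 where "g1 x = expect (V x) (\<lambda>z. ln (w0 x z))" for x
  define g2 where "g2 x x' = expect (V x) (\<lambda>z. pmf (V x') z / (w0 x z * pmf r z))" for x x'
  define g3 where "g3 x = expect (V x) (\<lambda>z. 1 / w0 x z)" for x
  have g3: "g3 x \<ge> 0" for x
    unfolding g3_def using w0[of x] by (intro integral_nonneg_AE AE_I2) (simp add: order_trans[OF zero_le_one])
  have rpos: "pmf r z > 0" if "x \<in> set_pmf P" "z \<in> set_pmf (V x)" for x z
    using that by (auto simp: r_def intro!: pmf_positive)
  \<comment> \<open>Averaging the other codeword over \<open>P\<close> turns its channel density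
    into \<open>r\<close>, which cancels.\<close>
  have Eg2: "expect P (g2 x) = g3 x" if x: "x \<in> set_pmf P" for x
  proof -
    have fx: "finite (set_pmf (V x))" using finV x by blast
    have "expect P (g2 x) = expect (V x) (\<lambda>z. expect P (\<lambda>x'. pmf (V x') z / (w0 x z * pmf r z)))"
      unfolding g2_def by (rule expect_swap[OF finP fx])
    also have "\<dots> = expect (V x) (\<lambda>z. pmf r z / (w0 x z * pmf r z))"
      by (simp add: r_def pmf_bind)
    also have "\<dots> = g3 x"
      unfolding g3_def
    proof (rule expect_cong)
      fix z assume "z \<in> set_pmf (V x)"
      from rpos[OF x this] show "pmf r z / (w0 x z * pmf r z) = 1 / w0 x z" by simp
    qed
    finally show ?thesis .
  qed
  have el: "e l \<in> I" if "l \<in> {1..L}" for l using e that by blast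
  have bound: "kl (bind_pmf (pmf_of_set {1..L}) (\<lambda>l. V (c (e l)))) r \<le>
      (\<Sum>l\<in>{1..L}. g1 (c (e l)) + (\<Sum>l'\<in>{1..L} - {l}. g2 (c (e l)) (c (e l'))) / real L - g3 (c (e l))) / real L"
    if c: "c \<in> set_pmf ?C" for c
  proof -
    let ?m = "bind_pmf (pmf_of_set {1..L}) (\<lambda>l. V (c (e l)))"
    have cP: "c (e l) \<in> set_pmf P" if "l \<in> {1..L}" for l
      using codebook_in_set[OF I c el[OF that]] .
    have fV: "finite (set_pmf (V (c (e l))))" if "l \<in> {1..L}" for l using cP[OF that] finV by blast
    have m: "pmf ?m z = (\<Sum>l\<in>{1..L}. pmf (V (c (e l))) z) / real L" for z
      using L by (subst pmf_bind_pmf_of_set) auto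
    have "kl ?m r = expect (pmf_of_set {1..L}) (\<lambda>l. expect (V (c (e l))) (\<lambda>z. ln (pmf ?m z / pmf r z)))"
      unfolding kl_def using L fV by (subst expect_bind) auto
    also have "\<dots> = (\<Sum>l\<in>{1..L}. expect (V (c (e l))) (\<lambda>z. ln (pmf ?m z / pmf r z))) / real L"
      by (rule expect_uniform[OF L])
    also have "\<dots> \<le> (\<Sum>l\<in>{1..L}. g1 (c (e l)) + (\<Sum>l'\<in>{1..L} - {l}. g2 (c (e l)) (c (e l'))) / real L - g3 (c (e l))) / real L"
    proof (intro divide_right_mono sum_mono)
      fix l assume l: "l \<in> {1..L}"
      let ?x = "c (e l)"
      have "expect (V ?x) (\<lambda>z. ln (pmf ?m z / pmf r z)) \<le>
        expect (V ?x) (\<lambda>z. ln (w0 ?x z) + (\<Sum>l'\<in>{1..L} - {l}. pmf (V (c (e l'))) z / (w0 ?x z * pmf r z)) / real L - 1 / w0 ?x z)"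
      proof (rule expect_mono[OF fV[OF l]])
        fix z assume z: "z \<in> set_pmf (V ?x)"
        have r: "pmf r z > 0" by (rule rpos[OF cP[OF l] z])
        define s where "s = (\<Sum>l'\<in>{1..L} - {l}. pmf (V (c (e l'))) z)"
        have s: "s \<ge> 0" by (simp add: s_def sum_nonneg)
        have ms: "pmf ?m z / pmf r z = w0 ?x z - 1 + s / (real L * pmf r z)"
          unfolding m s_def w0_def using l L r by (simp add: sum.remove[of _ l] field_simps)
        have "z \<in> set_pmf ?m" using l z L by (auto intro!: bexI[of _ l])
        then have pos: "w0 ?x z > 0" "pmf ?m z > 0"
          using w0[of ?x z] by (auto intro!: pmf_positive)
        have "ln (pmf ?m z / pmf r z) = ln (w0 ?x z) + ln (pmf ?m z / pmf r z / w0 ?x z)"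
          using pos r by (simp add: ln_div ln_mult)
        also have "\<dots> \<le> ln (w0 ?x z) + (pmf ?m z / pmf r z / w0 ?x z - 1)"
          using pos r by (intro add_left_mono ln_le_minus_one) auto
        also have "pmf ?m z / pmf r z / w0 ?x z - 1 = s / (w0 ?x z * pmf r z) / real L - 1 / w0 ?x z"
          unfolding ms using pos r L by (simp add: field_simps)
        finally show "ln (pmf ?m z / pmf r z) \<le>
          ln (w0 ?x z) + (\<Sum>l'\<in>{1..L} - {l}. pmf (V (c (e l'))) z / (w0 ?x z * pmf r z)) / real L - 1 / w0 ?x z"
          by (simp add: s_def sum_divide_distrib)
      qed
      also have "\<dots> = g1 ?x + (\<Sum>l'\<in>{1..L} - {l}. g2 ?x (c (e l'))) / real L - g3 ?x"
        unfolding g1_def g2_def g3_def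
        by (simp add: integrable_measure_pmf_finite[OF fV[OF l]])
      finally show "expect (V ?x) (\<lambda>z. ln (pmf ?m z / pmf r z)) \<le>
        g1 ?x + (\<Sum>l'\<in>{1..L} - {l}. g2 ?x (c (e l'))) / real L - g3 ?x" .
    qed simp
    finally show ?thesis .
  qed
  have "expect ?C (\<lambda>c. kl (bind_pmf (pmf_of_set {1..L}) (\<lambda>l. V (c (e l)))) r) \<le>
    expect ?C (\<lambda>c. (\<Sum>l\<in>{1..L}. g1 (c (e l)) + (\<Sum>l'\<in>{1..L} - {l}. g2 (c (e l)) (c (e l'))) / real L - g3 (c (e l))) / real L)"
    by (rule expect_mono[OF finC bound])
  also have "\<dots> = (\<Sum>l\<in>{1..L}. expect ?C (\<lambda>c. g1 (c (e l)))
      + (\<Sum>l'\<in>{1..L} - {l}. expect ?C (\<lambda>c. g2 (c (e l)) (c (e l')))) / real L - expect ?C (\<lambda>c. g3 (c (e l)))) / real L"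
    by (simp add: integrable_measure_pmf_finite[OF finC])
  \<comment> \<open>The L - 1 other codewords add (L - 1) / L times the mean of \<open>g3\<close>,
    and the tangent subtracts that mean once, so the balance is nonpositive.\<close>
  also have "\<dots> = (\<Sum>l\<in>{1..L}. expect P g1 - expect P g3 / real L) / real L"
  proof (intro arg_cong2[where f = "(/)"] sum.cong refl)
    fix l assume l: "l \<in> {1..L}"
    have "expect ?C (\<lambda>c. g2 (c (e l)) (c (e l'))) = expect P g3" if "l' \<in> {1..L} - {l}" for l'
    proof -
      have "e l \<noteq> e l'" using e(1) l that by (auto dest: inj_onD)
      then have "expect ?C (\<lambda>c. g2 (c (e l)) (c (e l'))) = expect P (\<lambda>x. expect P (g2 x))"
        using l that el by (intro expect_codebook2 I finP) auto
      also have "\<dots> = expect P g3" by (rule expect_cong) (rule Eg2)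
      finally show ?thesis .
    qed
    then have "(\<Sum>l'\<in>{1..L} - {l}. expect ?C (\<lambda>c. g2 (c (e l)) (c (e l')))) / real L
        = (real L - 1) * expect P g3 / real L"
      using l L by (simp add: of_nat_diff)
    moreover have "expect ?C (\<lambda>c. g1 (c (e l))) = expect P g1" "expect ?C (\<lambda>c. g3 (c (e l))) = expect P g3"
      using expect_codebook[OF I el[OF l]] by auto
    ultimately show "expect ?C (\<lambda>c. g1 (c (e l)))
      + (\<Sum>l'\<in>{1..L} - {l}. expect ?C (\<lambda>c. g2 (c (e l)) (c (e l')))) / real L - expect ?C (\<lambda>c. g3 (c (e l)))
      = expect P g1 - expect P g3 / real L"
      using L by (simp add: field_simps)
  qed
  also have "\<dots> = expect P g1 - expect P g3 / real L" using L by simp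
  also have "\<dots> \<le> expect P g1" using g3 by (simp add: integral_nonneg_AE)
  also have "\<dots> = expect (joint P V) (\<lambda>(x, z). ln (w0 x z))"
    by (simp add: expect_joint[OF finP finV] g1_def[abs_def])
  finally show ?thesis by (simp add: w0_def)
qed


section \<open>Threshold decoding for all channel states at once\<close>

definition score_set ::
  "nat \<Rightarrow> 'x pmf \<Rightarrow> (nat \<Rightarrow> 'x \<Rightarrow> 'y pmf) \<Rightarrow> real \<Rightarrow> ('x \<times> 'y) set" where
  "score_set T P W \<tau> =
     {(x, y). \<exists>t\<in>{1..T}. \<tau> * (\<Sum>t'\<in>{1..T}. pmf (bind_pmf P (W t')) y) < pmf (W t x) y}"

text \<open>A change of measure: the sum of the output densities dominates the actual one, so at
  every accepted y the actual density is at most 1 / \<tau> times the likelihood of some state.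
  Summing over the possible states costs the factor T.\<close>

lemma score_set_false_alarm:
  assumes finP: "finite (set_pmf P)" and finW: "\<And>t. \<forall>x\<in>set_pmf P. finite (set_pmf (W t x))"
    and t: "t \<in> {1..T}" and x: "x \<in> set_pmf P" and \<tau>: "\<tau> > 0"
  shows "measure_pmf.prob (bind_pmf P (W t)) {y. (x, y) \<in> score_set T P W \<tau>} \<le> real T / \<tau>"
proof -
  let ?q = "bind_pmf P (W t)"
  let ?A = "set_pmf ?q \<inter> {y. (x, y) \<in> score_set T P W \<tau>}"
  have finq: "finite (set_pmf ?q)" using finP finW by auto
  have le: "pmf ?q y \<le> (\<Sum>t'\<in>{1..T}. pmf (bind_pmf P (W t')) y)" for y
    using t by (intro member_le_sum[of t "{1..T}" "\<lambda>t'. pmf (bind_pmf P (W t')) y"]) auto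
  have "measure_pmf.prob ?q {y. (x, y) \<in> score_set T P W \<tau>} = measure_pmf.prob ?q ?A"
    by (intro measure_prob_cong_0) (auto simp: pmf_eq_0_set_pmf)
  also have "\<dots> = (\<Sum>y\<in>?A. pmf ?q y)"
    using finq by (intro measure_measure_pmf_finite) auto
  also have "\<dots> \<le> (\<Sum>y\<in>?A. \<Sum>t'\<in>{1..T}. pmf (W t' x) y / \<tau>)"
  proof (rule sum_mono)
    fix y assume "y \<in> ?A"
    then obtain t' where t': "t' \<in> {1..T}"
      "\<tau> * (\<Sum>t'\<in>{1..T}. pmf (bind_pmf P (W t')) y) < pmf (W t' x) y"
      by (auto simp: score_set_def)
    have "\<tau> * pmf ?q y \<le> \<tau> * (\<Sum>t'\<in>{1..T}. pmf (bind_pmf P (W t')) y)"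
      using \<tau> by (intro mult_left_mono le) simp
    with t'(2) have "\<tau> * pmf ?q y \<le> pmf (W t' x) y" by linarith
    then have "pmf ?q y \<le> pmf (W t' x) y / \<tau>" using \<tau> by (simp add: field_simps)
    also have "\<dots> \<le> (\<Sum>t'\<in>{1..T}. pmf (W t' x) y / \<tau>)"
      using t' \<tau> by (intro member_le_sum[of t' "{1..T}" "\<lambda>t'. pmf (W t' x) y / \<tau>"]) auto
    finally show "pmf ?q y \<le> (\<Sum>t'\<in>{1..T}. pmf (W t' x) y / \<tau>)" .
  qed
  also have "\<dots> = (\<Sum>t'\<in>{1..T}. (\<Sum>y\<in>?A. pmf (W t' x) y) / \<tau>)"
    by (subst sum.swap) (simp add: sum_divide_distrib)
  also have "\<dots> \<le> (\<Sum>t'\<in>{1..T}. 1 / \<tau>)"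
  proof (intro sum_mono divide_right_mono)
    fix t'
    have "(\<Sum>y\<in>?A. pmf (W t' x) y) = measure_pmf.prob (W t' x) ?A"
      using finq by (intro measure_measure_pmf_finite[symmetric]) auto
    then show "(\<Sum>y\<in>?A. pmf (W t' x) y) \<le> 1" by simp
  qed (use \<tau> in simp)
  finally show ?thesis by simp
qed

text \<open>Only a codeword of another message counts as a collision: the local randomness l need
  not be recovered. Exclusion of all competitors gives disjointness by construction.\<close>

definition decoding_set ::
  "nat set \<Rightarrow> nat set \<Rightarrow> ('x \<times> 'y) set \<Rightarrow> (nat \<times> nat \<Rightarrow> 'x) \<Rightarrow> nat \<Rightarrow> 'y set" where
  "decoding_set M N A c j =
     {y. (\<exists>l\<in>N. (c (j, l), y) \<in> A) \<and> (\<forall>j'\<in>M - {j}. \<forall>l\<in>N. (c (j', l), y) \<notin> A)}"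

lemma disjoint_decoding_set: "disjoint_family_on (decoding_set M N A c) M"
  unfolding disjoint_family_on_def decoding_set_def by blast

text \<open>A union bound: either the sent codeword fails its own test or a codeword of another
  message passes. The competitor is independent of the sent codeword; once the competitor is fixed
  by swapping expectations, the received word has the output distribution and the false alarm bound
  applies.\<close>

lemma random_decoding_error:
  fixes P :: "'x pmf"
  assumes finP: "finite (set_pmf P)" and finW: "\<And>t. \<forall>x\<in>set_pmf P. finite (set_pmf (W t x))"
    and t: "t \<in> {1..T}" and \<tau>: "\<tau> > 0"
    and fin: "finite M" "finite N" and j: "j \<in> M" and l: "l \<in> N"
  defines "A \<equiv> score_set T P W \<tau>"
  shows "expect (codebook (M \<times> N) P)
      (\<lambda>c. measure_pmf.prob (W t (c (j, l))) (- decoding_set M N A c j))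
    \<le> measure_pmf.prob (joint P (W t)) (- A) + real (card M) * real (card N) * (real T / \<tau>)"
proof -
  let ?C = "codebook (M \<times> N) P"
  let ?R = "(M - {j}) \<times> N"
  have finI: "finite (M \<times> N)" using fin by simp
  have finC: "finite (set_pmf ?C)" by (rule finite_set_codebook[OF finI finP])
  define a where "a x = measure_pmf.prob (W t x) {y. (x, y) \<notin> A}" for x
  define b where "b x x' = measure_pmf.prob (W t x) {y. (x', y) \<in> A}" for x x'
  have jl: "(j, l) \<in> M \<times> N" using j l by simp
  have Wt: "\<forall>x\<in>set_pmf P. finite (set_pmf (W t x))" by (rule finW)
  have "expect ?C (\<lambda>c. measure_pmf.prob (W t (c (j, l))) (- decoding_set M N A c j)) \<le>
    expect ?C (\<lambda>c. a (c (j, l)) + (\<Sum>i\<in>?R. b (c (j, l)) (c i)))"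
  proof (rule expect_mono[OF finC])
    fix c :: "nat \<times> nat \<Rightarrow> 'x"
    let ?x = "c (j, l)"
    have "measure_pmf.prob (W t ?x) (- decoding_set M N A c j) \<le>
      measure_pmf.prob (W t ?x) ({y. (?x, y) \<notin> A} \<union> (\<Union>i\<in>?R. {y. (c i, y) \<in> A}))"
    proof (rule measure_pmf.finite_measure_mono)
      show "- decoding_set M N A c j \<subseteq> {y. (?x, y) \<notin> A} \<union> (\<Union>i\<in>?R. {y. (c i, y) \<in> A})"
      proof
        fix y assume "y \<in> - decoding_set M N A c j"
        then have "(?x, y) \<notin> A \<or> (\<exists>j'\<in>M - {j}. \<exists>l\<in>N. (c (j', l), y) \<in> A)"
          unfolding decoding_set_def using l by blast
        then show "y \<in> {y. (?x, y) \<notin> A} \<union> (\<Union>i\<in>?R. {y. (c i, y) \<in> A})" by blast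
      qed
    qed simp
    also have "\<dots> \<le> a ?x + measure_pmf.prob (W t ?x) (\<Union>i\<in>?R. {y. (c i, y) \<in> A})"
      unfolding a_def by (rule measure_Un_le) simp_all
    also have "measure_pmf.prob (W t ?x) (\<Union>i\<in>?R. {y. (c i, y) \<in> A}) \<le> (\<Sum>i\<in>?R. b ?x (c i))"
      unfolding b_def using fin by (intro measure_UNION_le) simp_all
    finally show "measure_pmf.prob (W t ?x) (- decoding_set M N A c j) \<le> a ?x + (\<Sum>i\<in>?R. b ?x (c i))"
      by simp
  qed
  also have "\<dots> = expect ?C (\<lambda>c. a (c (j, l))) + (\<Sum>i\<in>?R. expect ?C (\<lambda>c. b (c (j, l)) (c i)))"
    by (simp add: integrable_measure_pmf_finite[OF finC])
  also have "expect ?C (\<lambda>c. a (c (j, l))) = expect P a"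
    by (rule expect_codebook[OF finI jl])
  also have "expect P a = measure_pmf.prob (joint P (W t)) (- A)"
  proof -
    have "measure_pmf.prob (joint P (W t)) (- A) =
        expect P (\<lambda>x. measure_pmf.prob (map_pmf (Pair x) (W t x)) (- A))"
      unfolding joint_def using Wt by (intro prob_bind finP) auto
    then show ?thesis by (simp add: a_def[abs_def] vimage_def)
  qed
  also have "(\<Sum>i\<in>?R. expect ?C (\<lambda>c. b (c (j, l)) (c i))) \<le> (\<Sum>i\<in>?R. real T / \<tau>)"
  proof (rule sum_mono)
    fix i assume i: "i \<in> ?R"
    have "expect ?C (\<lambda>c. b (c (j, l)) (c i)) = expect P (\<lambda>x. expect P (b x))"
      using i jl by (intro expect_codebook2 finI finP) auto
    also have "\<dots> = expect P (\<lambda>x'. expect P (\<lambda>x. b x x'))" by (rule expect_swap[OF finP finP])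
    also have "\<dots> \<le> expect P (\<lambda>_. real T / \<tau>)"
    proof (rule expect_mono[OF finP])
      fix x' assume x': "x' \<in> set_pmf P"
      have "expect P (\<lambda>x. b x x') = measure_pmf.prob (bind_pmf P (W t)) {y. (x', y) \<in> A}"
        unfolding b_def by (rule prob_bind[OF finP Wt, symmetric])
      also have "\<dots> \<le> real T / \<tau>"
        unfolding A_def by (rule score_set_false_alarm[OF finP finW t x' \<tau>])
      finally show "expect P (\<lambda>x. b x x') \<le> real T / \<tau>" .
    qed
    finally show "expect ?C (\<lambda>c. b (c (j, l)) (c i)) \<le> real T / \<tau>" by simp
  qed
  also have "(\<Sum>i\<in>?R. real T / \<tau>) \<le> real (card M) * real (card N) * (real T / \<tau>)"
  proof -
    have "real (card ?R) \<le> real (card M) * real (card N)"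
      unfolding of_nat_mult[symmetric] of_nat_le_iff card_cartesian_product
      by (intro mult_right_mono card_mono fin) auto
    from mult_right_mono[OF this, of "real T / \<tau>"] show ?thesis using \<tau> by simp
  qed
  finally show ?thesis by simp
qed

text \<open>Twice as many messages as needed are drawn and the worse half is discarded, which turns a
  bound on the average over the messages into a bound for every message, for the decoding error and
  the relative entropy simultaneously.\<close>

lemma one_shot_wiretap_code:
  fixes P :: "'x pmf" and W :: "nat \<Rightarrow> 'x \<Rightarrow> 'y pmf" and V :: "nat \<Rightarrow> 'x \<Rightarrow> 'z pmf" and T :: nat
  assumes finP: "finite (set_pmf P)" and finW: "\<And>t. \<forall>x\<in>set_pmf P. finite (set_pmf (W t x))"
    and finV: "\<And>t. \<forall>x\<in>set_pmf P. finite (set_pmf (V t x))"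
    and \<tau>: "\<tau> > 0" and J: "J \<ge> (1::nat)" and L: "L \<ge> (1::nat)"
  defines "\<epsilon> \<equiv> \<Sum>t\<in>{1..T}. measure_pmf.prob (joint P (W t)) (- score_set T P W \<tau>)
      + 2 * real J * real L * (real T / \<tau>)
      + expect (joint P (V t)) (\<lambda>(x, z). ln (1 + pmf (V t x) z / (real L * pmf (bind_pmf P (V t)) z)))"
  shows "\<exists>c D. (\<forall>j\<in>{1..J}. \<forall>l\<in>{1..L}. c j l \<in> set_pmf P) \<and> disjoint_family_on D {1..J} \<and>
    (\<forall>t\<in>{1..T}. \<forall>j\<in>{1..J}.
      (\<Sum>l\<in>{1..L}. measure_pmf.prob (W t (c j l)) (- D j)) / real L \<le> 2 * \<epsilon> \<and>
      kl (bind_pmf (pmf_of_set {1..L}) (\<lambda>l. V t (c j l))) (bind_pmf P (V t)) \<le> 2 * \<epsilon>)"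
proof -
  define M where "M = {1..2 * J}"
  define N where "N = {1..L}"
  define A where "A = score_set T P W \<tau>"
  let ?C = "codebook (M \<times> N) P"
  have fin: "finite M" "finite N" by (simp_all add: M_def N_def)
  then have finI: "finite (M \<times> N)" by simp
  have finC: "finite (set_pmf ?C)" by (rule finite_set_codebook[OF finI finP])
  define err where "err c t j = (\<Sum>l\<in>N. measure_pmf.prob (W t (c (j, l))) (- decoding_set M N A c j)) / real L"
    for c :: "nat \<times> nat \<Rightarrow> 'x" and t j
  define lk where "lk c t j = kl (bind_pmf (pmf_of_set {1..L}) (\<lambda>l. V t (c (j, l)))) (bind_pmf P (V t))"
    for c :: "nat \<times> nat \<Rightarrow> 'x" and t j
  \<comment> \<open>One cost per message collects every state and both criteria. All summands are
    nonnegative, so a bound on the cost bounds each of them.\<close>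
  define f where "f c j = (\<Sum>t\<in>{1..T}. err c t j + lk c t j)" for c j
  have Eerr: "expect ?C (\<lambda>c. err c t j) \<le> measure_pmf.prob (joint P (W t)) (- A) + 2 * real J * real L * (real T / \<tau>)"
    if t: "t \<in> {1..T}" and j: "j \<in> M" for t j
  proof -
    have "expect ?C (\<lambda>c. err c t j) =
      (\<Sum>l\<in>N. expect ?C (\<lambda>c. measure_pmf.prob (W t (c (j, l))) (- decoding_set M N A c j))) / real L"
      unfolding err_def by (simp add: integrable_measure_pmf_finite[OF finC])
    also have "\<dots> \<le> (\<Sum>l\<in>N. measure_pmf.prob (joint P (W t)) (- A) + real (card M) * real (card N) * (real T / \<tau>)) / real L"
      unfolding A_def using j
      by (intro divide_right_mono sum_mono random_decoding_error[OF finP finW t \<tau> fin]) auto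
    also have "\<dots> = measure_pmf.prob (joint P (W t)) (- A) + 2 * real J * real L * (real T / \<tau>)"
      using L by (simp add: M_def N_def)
    finally show ?thesis .
  qed
  have Elk: "expect ?C (\<lambda>c. lk c t j) \<le>
      expect (joint P (V t)) (\<lambda>(x, z). ln (1 + pmf (V t x) z / (real L * pmf (bind_pmf P (V t)) z)))"
    if j: "j \<in> M" for t j
    unfolding lk_def using j
    by (intro soft_covering[OF finP finV finI, where e = "Pair j"] L) (auto simp: inj_on_def N_def)
  have Ef: "expect ?C (\<lambda>c. f c j) \<le> \<epsilon>" if j: "j \<in> M" for j
  proof -
    have "expect ?C (\<lambda>c. f c j) = (\<Sum>t\<in>{1..T}. expect ?C (\<lambda>c. err c t j) + expect ?C (\<lambda>c. lk c t j))"
      unfolding f_def by (simp add: integrable_measure_pmf_finite[OF finC])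
    also have "\<dots> \<le> \<epsilon>"
      unfolding \<epsilon>_def A_def[symmetric] using Eerr j Elk[OF j] by (intro sum_mono add_mono) auto
    finally show ?thesis .
  qed
  obtain c where c: "c \<in> set_pmf ?C" and cle: "(\<Sum>j\<in>M. f c j) \<le> expect ?C (\<lambda>c. \<Sum>j\<in>M. f c j)"
    using exists_le_expect[OF finC, of "\<lambda>c. \<Sum>j\<in>M. f c j"] by blast
  have cP: "c (j, l) \<in> set_pmf P" if "j \<in> M" "l \<in> N" for j l
    using codebook_in_set[OF finI c] that by simp
  have "expect ?C (\<lambda>c. \<Sum>j\<in>M. f c j) = (\<Sum>j\<in>M. expect ?C (\<lambda>c. f c j))"
    by (rule expect_sum_distrib[OF finC])
  also have "\<dots> \<le> (\<Sum>j\<in>M. \<epsilon>)" by (rule sum_mono) (rule Ef)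
  finally have total: "(\<Sum>j\<in>M. f c j) \<le> 2 * real J * \<epsilon>" using cle by (simp add: M_def)
  have err0: "err c t j \<ge> 0" for t j by (simp add: err_def sum_nonneg)
  have lk0: "lk c t j \<ge> 0" if "j \<in> M" for t j
    unfolding lk_def
  proof (rule kl_nonneg)
    have sub: "set_pmf (V t (c (j, l))) \<subseteq> set_pmf (bind_pmf P (V t))" if "l \<in> {1..L}" for l
      using cP[OF \<open>j \<in> M\<close>, of l] that by (auto simp: N_def)
    show fin2: "finite (set_pmf (bind_pmf P (V t)))" using finP finV by auto
    have "set_pmf (bind_pmf (pmf_of_set {1..L}) (\<lambda>l. V t (c (j, l)))) =
        (\<Union>l\<in>{1..L}. set_pmf (V t (c (j, l))))" using L by simp
    then show "set_pmf (bind_pmf (pmf_of_set {1..L}) (\<lambda>l. V t (c (j, l)))) \<subseteq> set_pmf (bind_pmf P (V t))"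
      using sub by blast
    then show "finite (set_pmf (bind_pmf (pmf_of_set {1..L}) (\<lambda>l. V t (c (j, l)))))"
      using fin2 by (rule finite_subset)
  qed
  have f0: "f c j \<ge> 0" if "j \<in> M" for j
    unfolding f_def using err0 lk0[OF that] by (intro sum_nonneg add_nonneg_nonneg) auto
  have comp: "err c t j \<le> f c j \<and> lk c t j \<le> f c j" if "j \<in> M" "t \<in> {1..T}" for t j
  proof -
    have "err c t j + lk c t j \<le> f c j"
      unfolding f_def using that err0 lk0[OF that(1)]
      by (intro member_le_sum[of t "{1..T}" "\<lambda>t. err c t j + lk c t j"]) (auto intro: add_nonneg_nonneg)
    then show ?thesis using err0[of t j] lk0[OF that(1), of t] by linarith
  qed
  define G where "G = {j\<in>M. f c j \<le> 2 * \<epsilon>}"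
  have "card G \<ge> J"
  proof (rule ccontr)
    assume "\<not> card G \<ge> J"
    then have "card G < J" by simp
    have "card (M - G) = 2 * J - card G"
      by (subst card_Diff_subset) (auto simp: G_def M_def intro: finite_subset[of _ "{1..2*J}"])
    \<comment> \<open>Markov's inequality by counting: more than \<open>J\<close> messages of cost
      above 2 * \<epsilon> would exceed the total budget 2 * J * \<epsilon>.\<close>
    then have cG: "real (card (M - G)) \<ge> real J + 1" using \<open>card G < J\<close> by linarith
    then have "M - G \<noteq> {}" by (metis card.empty of_nat_0 not_le zero_less_one add_nonneg_pos of_nat_0_le_iff)
    then have "(\<Sum>j\<in>M - G. 2 * \<epsilon>) < (\<Sum>j\<in>M - G. f c j)"
      using fin by (intro sum_strict_mono) (auto simp: G_def)
    also have "\<dots> \<le> (\<Sum>j\<in>M. f c j)" using fin f0 by (intro sum_mono2) auto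
    finally have "real (card (M - G)) * (2 * \<epsilon>) < 2 * real J * \<epsilon>" using total by simp
    moreover have "\<epsilon> \<ge> 0"
    proof -
      have "0 \<le> (\<Sum>j\<in>M. f c j)" using f0 by (rule sum_nonneg)
      with total have "0 \<le> (2 * real J) * \<epsilon>" by linarith
      then show ?thesis using J by (subst (asm) zero_le_mult_iff) auto
    qed
    then have "real (card (M - G)) * (2 * \<epsilon>) \<ge> real J * (2 * \<epsilon>)"
      using cG by (intro mult_right_mono) auto
    ultimately show False by simp
  qed
  then obtain G' where G': "G' \<subseteq> G" "card G' = J" by (meson obtain_subset_with_card_n)
  have "finite G'" using G' fin by (auto simp: G_def intro: finite_subset)
  from ex_bij_betw_nat_finite_1[OF this] obtain h where h: "bij_betw h {1..J} G'"
    unfolding G'(2) by blast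
  have hM: "h j \<in> M \<and> f c (h j) \<le> 2 * \<epsilon>" if "j \<in> {1..J}" for j
    using bij_betwE[OF h] that G' by (auto simp: G_def)
  \<comment> \<open>The decoding sets of the full codebook are kept for the surviving messages, so
    the error bounds carry over unchanged.\<close>
  let ?D = "\<lambda>j. decoding_set M N A c (h j)"
  have "disjoint_family_on ?D {1..J}"
    using disjoint_decoding_set[of M N A c] bij_betw_imp_inj_on[OF h] hM
    unfolding disjoint_family_on_def by (metis inj_on_def)
  moreover have "(\<Sum>l\<in>{1..L}. measure_pmf.prob (W t (c (h j, l))) (- ?D j)) / real L \<le> 2 * \<epsilon> \<and>
      kl (bind_pmf (pmf_of_set {1..L}) (\<lambda>l. V t (c (h j, l)))) (bind_pmf P (V t)) \<le> 2 * \<epsilon>"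
    if "t \<in> {1..T}" "j \<in> {1..J}" for t j
    using comp[of "h j" t] hM[OF that(2)] that(1) unfolding err_def lk_def N_def by force
  moreover have "\<forall>j\<in>{1..J}. \<forall>l\<in>{1..L}. c (h j, l) \<in> set_pmf P"
    using cP hM by (auto simp: N_def)
  ultimately show ?thesis by (intro exI[of _ "\<lambda>j l. c (h j, l)"] exI[of _ ?D]) blast
qed

subsection \<open>Exponential decay for memoryless channels\<close>

text \<open>The recursion mirrors that of \<open>memoryless_ext\<close>, so that input and channel
  factor together one letter at a time.\<close>

primrec iid :: "nat \<Rightarrow> 'u pmf \<Rightarrow> 'u list pmf" where
  "iid 0 p = return_pmf []"
| "iid (Suc k) p = map_pmf (\<lambda>(u, us). u # us) (pair_pmf p (iid k p))"

lemma finite_set_iid: "finite (set_pmf p) \<Longrightarrow> finite (set_pmf (iid k p))"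
  by (induction k) auto

lemma set_iid: "us \<in> set_pmf (iid k p) \<Longrightarrow> length us = k \<and> set us \<subseteq> set_pmf p"
  by (induction k arbitrary: us) fastforce+

lemma finite_set_memoryless_ext:
  "(\<And>u. finite (set_pmf (W u))) \<Longrightarrow> finite (set_pmf (memoryless_ext W us))"
  by (induction us) auto

lemma joint_iid_Suc:
  "joint (iid (Suc k) p) (memoryless_ext W) =
    map_pmf (\<lambda>((u, y), (us, ys)). (u # us, y # ys))
      (pair_pmf (joint p W) (joint (iid k p) (memoryless_ext W)))"
  unfolding joint_def
  by (simp add: pair_pmf_def map_pmf_def bind_assoc_pmf bind_return_pmf
      bind_commute_pmf[of "iid k p"])

lemma bind_iid: "bind_pmf (iid k p) (memoryless_ext W) = iid k (bind_pmf p W)"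
proof (induction k)
  case (Suc k)
  show ?case
    unfolding iid.simps Suc.IH[symmetric]
    by (simp add: pair_pmf_def map_pmf_def bind_assoc_pmf bind_return_pmf
        bind_commute_pmf[of "iid k p"])
qed (simp add: bind_return_pmf)

lemma pmf_map_Cons:
  "pmf (map_pmf (\<lambda>(u, us). u # us) (pair_pmf p q)) (u # us) = pmf p u * pmf q us"
  using pmf_map_inj'[of "\<lambda>(u, us). u # us" "pair_pmf p q" "(u, us)"] by (simp add: inj_on_def pmf_pair)

text \<open>The information density in nats; its mean under \<open>joint p W\<close> is the mutual
  information times \<open>ln 2\<close>.\<close>

definition llr :: "'u pmf \<Rightarrow> ('u \<Rightarrow> 'y pmf) \<Rightarrow> 'u \<times> 'y \<Rightarrow> real" where
  "llr p W = (\<lambda>(u, y). ln (pmf (W u) y / pmf (bind_pmf p W) y))"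

lemma set_joint_pos:
  assumes "(u, y) \<in> set_pmf (joint p W)"
  shows "pmf (W u) y > 0" "pmf (bind_pmf p W) y > 0"
  using assms by (auto simp: set_joint intro!: pmf_positive)

text \<open>The information density of the block is a sum of independent terms, one per letter. The
  shift \<open>a\<close> carries the threshold per letter, so that each exponential bound becomes
  the k-th power of a single number.\<close>

lemma expect_exp_llr_iid:
  assumes finp: "finite (set_pmf p)" and finW: "\<And>u. finite (set_pmf (W u))"
  shows "expect (joint (iid k p) (memoryless_ext W)) (\<lambda>x. exp (s * llr (iid k p) (memoryless_ext W) x + real k * a))
    = (expect (joint p W) (\<lambda>x. exp (s * llr p W x + a))) ^ k"
proof (induction k)
  case 0
  then show ?case by (simp add: joint_def llr_def bind_return_pmf)
next
  case (Suc k)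
  let ?M = "memoryless_ext W"
  let ?J = "joint p W" and ?Jk = "joint (iid k p) ?M"
  let ?f = "\<lambda>x. exp (s * llr p W x + a)"
  let ?fk = "\<lambda>x. exp (s * llr (iid k p) ?M x + real k * a)"
  have finJ: "finite (set_pmf ?J)" by (intro finite_set_joint finp ballI finW)
  have finJk: "finite (set_pmf ?Jk)"
    by (intro finite_set_joint finite_set_iid finp ballI finite_set_memoryless_ext finW)
  have factor: "exp (s * llr (iid (Suc k) p) ?M ((\<lambda>((u, y), (us, ys)). (u # us, y # ys)) z) + real (Suc k) * a) =
      ?f (fst z) * ?fk (snd z)" if z: "z \<in> set_pmf (pair_pmf ?J ?Jk)" for z
  proof -
    obtain u y us ys where zeq: "z = ((u, y), (us, ys))" by (metis surj_pair)
    with z have 1: "(u, y) \<in> set_pmf ?J" and 2: "(us, ys) \<in> set_pmf ?Jk" by auto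
    note pos = set_joint_pos[OF 1] set_joint_pos[OF 2]
    have "llr (iid (Suc k) p) ?M (u # us, y # ys) = llr p W (u, y) + llr (iid k p) ?M (us, ys)"
      using pos unfolding llr_def bind_iid
      by (simp add: pmf_map_Cons ln_div ln_mult del: set_bind_pmf)
    then show ?thesis
      by (simp add: zeq exp_add[symmetric] algebra_simps)
  qed
  have "expect (joint (iid (Suc k) p) ?M) (\<lambda>x. exp (s * llr (iid (Suc k) p) ?M x + real (Suc k) * a)) =
    expect (pair_pmf ?J ?Jk) (\<lambda>z. ?f (fst z) * ?fk (snd z))"
    unfolding joint_iid_Suc integral_map_pmf by (rule expect_cong) (rule factor)
  also have "\<dots> = expect ?J ?f * expect ?Jk ?fk"
    unfolding expect_pair[OF finJ finJk] by simp
  finally show ?case using Suc.IH by simp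
qed

text \<open>As a function of s the moment is one at zero and has the negative mean of
  \<open>X\<close> as derivative there. The bound s \<le> 1 serves
  \<open>ln_one_plus_exp_le\<close>.\<close>

lemma exists_exp_moment_less_one:
  assumes fin: "finite (set_pmf M)" and neg: "expect M X < 0"
  shows "\<exists>s. 0 < s \<and> s \<le> 1 \<and> expect M (\<lambda>x. exp (s * X x)) < 1"
proof -
  define F where "F s = (\<Sum>x\<in>set_pmf M. pmf M x * exp (s * X x))" for s
  have "(F has_real_derivative (\<Sum>x\<in>set_pmf M. pmf M x * (exp (0 * X x) * X x))) (at 0)"
    unfolding F_def by (auto intro!: derivative_eq_intros sum.cong)
  moreover have "(\<Sum>x\<in>set_pmf M. pmf M x * (exp (0 * X x) * X x)) < 0"
    using neg by (simp add: expect_sum[OF fin])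
  ultimately obtain d where d: "d > 0" "\<And>h. 0 < h \<Longrightarrow> h < d \<Longrightarrow> F (0 + h) < F 0"
    using DERIV_neg_dec_right[of F _ 0] by blast
  have F0: "F 0 = 1" using fin by (simp add: F_def sum_pmf_eq_1)
  let ?s = "min 1 (d / 2)"
  have "F ?s < 1" using d(2)[of ?s] d(1) F0 by (simp add: min_def)
  then show ?thesis using d(1) unfolding F_def expect_sum[OF fin, symmetric] by (intro exI[of _ ?s]) auto
qed

text \<open>Converts the logarithm of the covering bound into an exponential moment of small order.
  The left side behaves like exp w for negative w and grows linearly for positive w; the factor 1 /
  s absorbs the linear growth.\<close>

lemma ln_one_plus_exp_le:
  fixes w s :: real
  assumes "0 < s" "s \<le> 1"
  shows "ln (1 + exp w) \<le> exp (s * w) / s"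
proof (cases "w \<le> 0")
  case True
  have "ln (1 + exp w) \<le> exp w" using ln_add_one_self_le_self[of "exp w"] by simp
  also have "\<dots> \<le> exp (s * w)" using True assms by (simp add: mult_le_cancel_right1)
  also have "\<dots> \<le> exp (s * w) / s" using assms by (simp add: field_simps)
  finally show ?thesis .
next
  case False
  have "ln (1 + exp w) = ln (exp w * (1 + exp (- w)))" by (simp add: algebra_simps exp_add[symmetric])
  also have "\<dots> = w + ln (1 + exp (- w))" using add_pos_pos[OF zero_less_one exp_gt_zero, of "- w"] by (simp add: ln_mult)
  also have "ln (1 + exp (- w)) \<le> exp (- w)" using ln_add_one_self_le_self[of "exp (- w)"] by simp
  also have "exp (- w) \<le> 1" using False by simp
  also have "w + 1 \<le> (1 + s * w) / s" using assms by (simp add: field_simps)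
  also have "\<dots> \<le> exp (s * w) / s"
    using assms exp_ge_add_one_self[of "s * w"] by (intro divide_right_mono) auto
  finally show ?thesis by simp
qed

lemma prob_le_expect:
  assumes fin: "finite (set_pmf M)" and "\<And>x. x \<in> set_pmf M \<Longrightarrow> f x \<ge> 0"
    and "\<And>x. x \<in> set_pmf M \<Longrightarrow> x \<in> A \<Longrightarrow> f x \<ge> 1"
  shows "measure_pmf.prob M A \<le> expect M f"
proof -
  have "measure_pmf.prob M A = expect M (indicator A)" by simp
  also have "\<dots> \<le> expect M f" using assms by (intro expect_mono fin) (auto split: split_indicator)
  finally show ?thesis .
qed

text \<open>The score threshold refers to the sum of all output distributions; passing to the output
  distribution of the actual channel state costs a factor \<open>d\<close> outside an event of probability
  at most \<open>T / d\<close>.\<close>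

lemma score_set_missed_detection:
  fixes P :: "'x pmf" and W :: "nat \<Rightarrow> 'x \<Rightarrow> 'y pmf"
  assumes finP: "finite (set_pmf P)" and finW: "\<And>t. \<forall>x\<in>set_pmf P. finite (set_pmf (W t x))"
    and t: "t \<in> {1..T}" and \<tau>: "\<tau> > 0" and d: "d > 0"
  shows "measure_pmf.prob (joint P (W t)) (- score_set T P W \<tau>) \<le>
    measure_pmf.prob (joint P (W t)) {(x, y). pmf (W t x) y \<le> \<tau> * d * pmf (bind_pmf P (W t)) y} + real T / d"
proof -
  let ?q = "bind_pmf P (W t)"
  define S where "S y = (\<Sum>t'\<in>{1..T}. pmf (bind_pmf P (W t')) y)" for y
  let ?B = "{y. d * pmf ?q y < S y}"
  have finq: "finite (set_pmf ?q)" using finP finW by auto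
  have "- score_set T P W \<tau> \<subseteq> {(x, y). pmf (W t x) y \<le> \<tau> * d * pmf ?q y} \<union> snd -` ?B"
  proof (clarify)
    fix x y assume 1: "(x, y) \<notin> score_set T P W \<tau>" and 2: "(x, y) \<notin> snd -` ?B"
    have "pmf (W t x) y \<le> \<tau> * S y" using 1 t unfolding score_set_def S_def by force
    also have "\<dots> \<le> \<tau> * (d * pmf ?q y)" using 2 \<tau> by (intro mult_left_mono) auto
    finally show "pmf (W t x) y \<le> \<tau> * d * pmf ?q y" by (simp add: mult.assoc)
  qed
  then have "measure_pmf.prob (joint P (W t)) (- score_set T P W \<tau>) \<le>
    measure_pmf.prob (joint P (W t)) ({(x, y). pmf (W t x) y \<le> \<tau> * d * pmf ?q y} \<union> snd -` ?B)"
    by (rule measure_pmf.finite_measure_mono) simp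
  also have "\<dots> \<le> measure_pmf.prob (joint P (W t)) {(x, y). pmf (W t x) y \<le> \<tau> * d * pmf ?q y}
      + measure_pmf.prob (joint P (W t)) (snd -` ?B)"
    by (rule measure_Un_le) simp_all
  also have "measure_pmf.prob (joint P (W t)) (snd -` ?B) = measure_pmf.prob ?q ?B"
    unfolding map_snd_joint[symmetric, of P "W t"] by simp
  also have "\<dots> \<le> real T / d"
  proof -
    define X where "X = set_pmf ?q \<inter> ?B"
    have "measure_pmf.prob ?q ?B = measure_pmf.prob ?q X" unfolding X_def
      by (intro measure_prob_cong_0) (auto simp: pmf_eq_0_set_pmf)
    also have "\<dots> = (\<Sum>y\<in>X. pmf ?q y)"
      using finq unfolding X_def by (intro measure_measure_pmf_finite) auto
    also have "\<dots> \<le> (\<Sum>y\<in>X. S y / d)"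
      using d unfolding X_def by (intro sum_mono) (auto simp: field_simps)
    also have "\<dots> = (\<Sum>t'\<in>{1..T}. (\<Sum>y\<in>X. pmf (bind_pmf P (W t')) y) / d)"
      unfolding S_def sum_divide_distrib by (rule sum.swap)
    also have "\<dots> \<le> (\<Sum>t'\<in>{1..T}. 1 / d)"
    proof (intro sum_mono divide_right_mono)
      fix t'
      have "(\<Sum>y\<in>X. pmf (bind_pmf P (W t')) y) =
          measure_pmf.prob (bind_pmf P (W t')) (X)"
        using finq unfolding X_def by (intro measure_measure_pmf_finite[symmetric]) blast
      then show "(\<Sum>y\<in>X. pmf (bind_pmf P (W t')) y) \<le> 1" by simp
    qed (use d in simp)
    finally show ?thesis by simp
  qed
  finally show ?thesis by simp
qed

lemma nat_ceiling_exp_bounds: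
  assumes "x \<ge> (0::real)"
  shows "exp x \<le> real (nat \<lceil>exp x\<rceil>)" "real (nat \<lceil>exp x\<rceil>) \<le> 2 * exp x" "nat \<lceil>exp x\<rceil> \<ge> 1"
proof -
  have e: "exp x \<ge> 1" using assms by simp
  show "exp x \<le> real (nat \<lceil>exp x\<rceil>)" by (rule real_nat_ceiling_ge)
  have "real (nat \<lceil>exp x\<rceil>) = of_int \<lceil>exp x\<rceil>" using e by simp
  then show "real (nat \<lceil>exp x\<rceil>) \<le> 2 * exp x" using e ceiling_correct[of "exp x"] by linarith
  show "nat \<lceil>exp x\<rceil> \<ge> 1" using e real_nat_ceiling_ge[of "exp x"] by linarith
qed

lemma expect_llr_nonneg:
  assumes finp: "finite (set_pmf p)" and finW: "\<And>u. finite (set_pmf (W u))"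
  shows "expect (joint p W) (llr p W) \<ge> 0"
proof -
  have "expect (joint p W) (llr p W) = expect p (\<lambda>u. kl (W u) (bind_pmf p W))"
    using finp finW by (subst expect_joint) (auto simp: llr_def kl_def)
  also have "\<dots> \<ge> expect p (\<lambda>_. 0)"
    using finp finW by (intro expect_mono kl_nonneg) auto
  finally show ?thesis by simp
qed

text \<open>The rate \<rho> is in nats per block letter. The number of messages is prescribed so
  that the rate can be read off later, and one sequence \<epsilon> serves all states and
  messages.\<close>

theorem block_wiretap_codes:
  fixes p :: "'u pmf" and W :: "nat \<Rightarrow> 'u \<Rightarrow> 'y pmf" and V :: "nat \<Rightarrow> 'u \<Rightarrow> 'z pmf"
  assumes finp: "finite (set_pmf p)" and finW: "\<And>t u. finite (set_pmf (W t u))"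
    and finV: "\<And>t u. finite (set_pmf (V t u))" and T: "T \<ge> 1" and \<rho>: "\<rho> \<ge> 0"
    and gap: "\<And>t t'. t \<in> {1..T} \<Longrightarrow> t' \<in> {1..T} \<Longrightarrow>
      \<rho> < expect (joint p (W t)) (llr p (W t)) - expect (joint p (V t')) (llr p (V t'))"
  shows "\<exists>\<epsilon>. \<epsilon> \<longlonglongrightarrow> 0 \<and> (\<forall>k. \<exists>L\<ge>1. \<exists>c D.
    (\<forall>j\<in>{1..nat \<lceil>exp (real k * \<rho>)\<rceil>}. \<forall>l\<in>{1..L}. c j l \<in> set_pmf (iid k p)) \<and>
    disjoint_family_on D {1..nat \<lceil>exp (real k * \<rho>)\<rceil>} \<and>
    (\<forall>t\<in>{1..T}. \<forall>j\<in>{1..nat \<lceil>exp (real k * \<rho>)\<rceil>}.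
      (\<Sum>l\<in>{1..L}. measure_pmf.prob (memoryless_ext (W t) (c j l)) (- D j)) / real L \<le> \<epsilon> k \<and>
      kl (bind_pmf (pmf_of_set {1..L}) (\<lambda>l. memoryless_ext (V t) (c j l))) (iid k (bind_pmf p (V t))) \<le> \<epsilon> k))"
proof -
  define iw where "iw = Min ((\<lambda>t. expect (joint p (W t)) (llr p (W t))) ` {1..T})"
  define iv where "iv = Max ((\<lambda>t. expect (joint p (V t)) (llr p (V t))) ` {1..T})"
  have ne: "{1..T} \<noteq> {}" using T by simp
  have "iw \<in> (\<lambda>t. expect (joint p (W t)) (llr p (W t))) ` {1..T}"
    unfolding iw_def using ne by (intro Min_in) auto
  moreover have "iv \<in> (\<lambda>t. expect (joint p (V t)) (llr p (V t))) ` {1..T}"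
    unfolding iv_def using ne by (intro Max_in) auto
  ultimately have gap': "\<rho> < iw - iv" and iv0: "iv \<ge> 0"
    using gap expect_llr_nonneg[OF finp finV] by auto
  have iw: "iw \<le> expect (joint p (W t)) (llr p (W t))"
    and iv: "expect (joint p (V t)) (llr p (V t)) \<le> iv" if "t \<in> {1..T}" for t
    using that by (auto simp: iw_def iv_def)
  \<comment> \<open>The gap is cut into four equal parts: the randomness rate \<open>lam\<close>
    lies one part above \<open>iv\<close>, the receiver's deviation event one part below
    \<open>iw\<close>, one part pays for the factor \<open>d\<close>, and one is the exponent left
    for the union bound.\<close>
  define \<sigma> where "\<sigma> = (iw - iv - \<rho>) / 4"
  have \<sigma>: "\<sigma> > 0" using gap' by (simp add: \<sigma>_def)
  define lam where "lam = iv + \<sigma>"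
  define \<gamma> where "\<gamma> = iw - 2 * \<sigma>"
  have lam0: "lam \<ge> 0" using iv0 \<sigma> by (simp add: lam_def)
  have rates: "\<rho> + lam - \<gamma> = - \<sigma>" by (simp add: lam_def \<gamma>_def \<sigma>_def field_simps)
  have finJW: "finite (set_pmf (joint p (W t)))" and finJV: "finite (set_pmf (joint p (V t)))" for t
    by (intro finite_set_joint finp ballI finW finV)+
  have "\<forall>t\<in>{1..T}. \<exists>s. 0 < s \<and> s \<le> 1 \<and>
      expect (joint p (W t)) (\<lambda>x. exp (s * ((\<gamma> + \<sigma>) - llr p (W t) x))) < 1"
    using iw \<sigma> by (intro ballI exists_exp_moment_less_one finJW)
      (force simp: expect_diff[OF finJW] \<gamma>_def)
  then obtain sW where sW: "\<And>t. t \<in> {1..T} \<Longrightarrow> 0 < sW t"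
      "\<And>t. t \<in> {1..T} \<Longrightarrow> expect (joint p (W t)) (\<lambda>x. exp (sW t * ((\<gamma> + \<sigma>) - llr p (W t) x))) < 1"
    by metis
  have "\<forall>t\<in>{1..T}. \<exists>s. 0 < s \<and> s \<le> 1 \<and>
      expect (joint p (V t)) (\<lambda>x. exp (s * (llr p (V t) x - lam))) < 1"
    using iv \<sigma> by (intro ballI exists_exp_moment_less_one finJV)
      (force simp: expect_diff[OF finJV] lam_def)
  then obtain sV where sV: "\<And>t. t \<in> {1..T} \<Longrightarrow> 0 < sV t" "\<And>t. t \<in> {1..T} \<Longrightarrow> sV t \<le> 1"
      "\<And>t. t \<in> {1..T} \<Longrightarrow> expect (joint p (V t)) (\<lambda>x. exp (sV t * (llr p (V t) x - lam))) < 1"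
    by metis
  define a where "a t = expect (joint p (W t)) (\<lambda>x. exp (sW t * ((\<gamma> + \<sigma>) - llr p (W t) x)))" for t
  define b where "b t = expect (joint p (V t)) (\<lambda>x. exp (sV t * (llr p (V t) x - lam)))" for t
  \<comment> \<open>The leading 2 comes from discarding half of the messages. Of the 9, the share 8
    is the union bound with twice the messages and two rounded-up sizes, and 1 is the passage to the
    sum of output distributions.\<close>
  define \<epsilon> where "\<epsilon> k = 2 * (\<Sum>t\<in>{1..T}. a t ^ k + 9 * real T * exp (- \<sigma>) ^ k + b t ^ k / sV t)" for k :: nat
  have ab0: "a t \<ge> 0" "b t \<ge> 0" for t by (simp_all add: a_def b_def)
  have "(\<lambda>k. 2 * (\<Sum>t\<in>{1..T}. a t ^ k + 9 * real T * exp (- \<sigma>) ^ k + b t ^ k / sV t)) \<longlonglongrightarrow>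
      2 * (\<Sum>t\<in>{1..T}. 0 + 9 * real T * 0 + 0 / sV t)"
  proof (intro tendsto_mult tendsto_sum tendsto_add tendsto_divide tendsto_const LIMSEQ_power_zero)
    fix t assume t: "t \<in> {1..T}"
    show "norm (a t) < 1" using ab0[of t] sW(2)[OF t] by (simp add: a_def)
    show "norm (b t) < 1" using ab0[of t] sV(3)[OF t] by (simp add: b_def)
    show "norm (exp (- \<sigma>)) < 1" using \<sigma> by simp
    show "sV t \<noteq> 0" using sV(1)[OF t] by simp
  qed
  then have lim: "\<epsilon> \<longlonglongrightarrow> 0" by (simp add: \<epsilon>_def[abs_def])
  have "\<exists>L\<ge>1. \<exists>c D.
    (\<forall>j\<in>{1..nat \<lceil>exp (real k * \<rho>)\<rceil>}. \<forall>l\<in>{1..L}. c j l \<in> set_pmf (iid k p)) \<and>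
    disjoint_family_on D {1..nat \<lceil>exp (real k * \<rho>)\<rceil>} \<and>
    (\<forall>t\<in>{1..T}. \<forall>j\<in>{1..nat \<lceil>exp (real k * \<rho>)\<rceil>}.
      (\<Sum>l\<in>{1..L}. measure_pmf.prob (memoryless_ext (W t) (c j l)) (- D j)) / real L \<le> \<epsilon> k \<and>
      kl (bind_pmf (pmf_of_set {1..L}) (\<lambda>l. memoryless_ext (V t) (c j l))) (iid k (bind_pmf p (V t))) \<le> \<epsilon> k)"
    (is "\<exists>L\<ge>1. ?C L") for k
  proof -
    let ?P = "iid k p"
    let ?W = "\<lambda>t. memoryless_ext (W t)" and ?V = "\<lambda>t. memoryless_ext (V t)"
    define J where "J = nat \<lceil>exp (real k * \<rho>)\<rceil>"
    define L where "L = nat \<lceil>exp (real k * lam)\<rceil>"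
    define \<tau> where "\<tau> = exp (real k * \<gamma>)"
    define d where "d = exp (real k * \<sigma>)"
    note Jb = nat_ceiling_exp_bounds[of "real k * \<rho>", folded J_def]
    note Lb = nat_ceiling_exp_bounds[of "real k * lam", folded L_def]
    have J1: "J \<ge> 1" and L1: "L \<ge> 1" using Jb Lb \<rho> lam0 by simp_all
    have finP: "finite (set_pmf ?P)" by (rule finite_set_iid[OF finp])
    have finW': "\<And>t. \<forall>x\<in>set_pmf ?P. finite (set_pmf (?W t x))"
      and finV': "\<And>t. \<forall>x\<in>set_pmf ?P. finite (set_pmf (?V t x))"
      by (intro ballI finite_set_memoryless_ext finW finV)+
    have finJW': "finite (set_pmf (joint ?P (?W t)))" and finJV': "finite (set_pmf (joint ?P (?V t)))" for t
      by (intro finite_set_joint finP finW' finV')+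
    have \<tau>0: "\<tau> > 0" and d0: "d > 0" by (simp_all add: \<tau>_def d_def)
    have A: "measure_pmf.prob (joint ?P (?W t)) (- score_set T ?P ?W \<tau>) \<le> a t ^ k + real T * exp (- \<sigma>) ^ k"
      if t: "t \<in> {1..T}" for t
    proof -
      \<comment> \<open>The event that the information density is at most
        \<open>k * (\<gamma> + \<sigma>)\<close>, which lies at least \<open>k * \<sigma>\<close>
        below its mean; an exponential bound with the negative order \<open>- sW t\<close>
        applies.\<close>
      let ?B = "{(x, y). pmf (?W t x) y \<le> \<tau> * d * pmf (bind_pmf ?P (?W t)) y}"
      have "measure_pmf.prob (joint ?P (?W t)) ?B \<le>
        expect (joint ?P (?W t)) (\<lambda>x. exp ((- sW t) * llr ?P (?W t) x + real k * (sW t * (\<gamma> + \<sigma>))))"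
      proof (rule prob_le_expect[OF finJW'], simp, clarify)
        fix x y assume xy: "(x, y) \<in> set_pmf (joint ?P (?W t))"
          and le: "pmf (?W t x) y \<le> \<tau> * d * pmf (bind_pmf ?P (?W t)) y"
        note pos = set_joint_pos[OF xy]
        have "pmf (?W t x) y / pmf (bind_pmf ?P (?W t)) y \<le> exp (real k * (\<gamma> + \<sigma>))"
          using le pos by (simp add: \<tau>_def d_def exp_add[symmetric] field_simps)
        then have "llr ?P (?W t) (x, y) \<le> real k * (\<gamma> + \<sigma>)"
          unfolding llr_def using pos ln_le_cancel_iff[of "pmf (?W t x) y / pmf (bind_pmf ?P (?W t)) y"
            "exp (real k * (\<gamma> + \<sigma>))"] by simp
        then have "sW t * llr ?P (?W t) (x, y) \<le> sW t * (real k * (\<gamma> + \<sigma>))"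
          using sW(1)[OF t] by (intro mult_left_mono) auto
        then show "1 \<le> exp ((- sW t) * llr ?P (?W t) (x, y) + real k * (sW t * (\<gamma> + \<sigma>)))"
          by (simp add: algebra_simps)
      qed
      also have "\<dots> = a t ^ k"
        unfolding expect_exp_llr_iid[OF finp finW] a_def by (simp add: algebra_simps)
      finally have "measure_pmf.prob (joint ?P (?W t)) ?B \<le> a t ^ k" .
      moreover have "real T / d = real T * exp (- \<sigma>) ^ k"
        unfolding exp_of_nat_mult[symmetric]
        by (simp add: d_def exp_minus divide_inverse)
      ultimately show ?thesis
        using score_set_missed_detection[where W = ?W, OF finP finW' t \<tau>0 d0] by linarith
    qed
    have B: "2 * real J * real L * (real T / \<tau>) \<le> 8 * real T * exp (- \<sigma>) ^ k"
    proof -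
      have "real J * real L \<le> (2 * exp (real k * \<rho>)) * (2 * exp (real k * lam))"
        using Jb Lb \<rho> lam0 by (intro mult_mono) auto
      then have "2 * (real J * real L) * (real T / \<tau>) \<le> 2 * ((2 * exp (real k * \<rho>)) * (2 * exp (real k * lam))) * (real T / \<tau>)"
        using \<tau>0 by (intro mult_right_mono mult_left_mono) auto
      also have "\<dots> = 8 * real T * exp (real k * (\<rho> + lam - \<gamma>))"
        by (simp add: \<tau>_def ring_distribs right_diff_distrib exp_add exp_diff)
      also have "\<dots> = 8 * real T * exp (- \<sigma>) ^ k"
        unfolding rates exp_of_nat_mult[symmetric] ..
      finally show ?thesis by (simp add: mult.assoc)
    qed
    have C: "expect (joint ?P (?V t)) (\<lambda>(x, z). ln (1 + pmf (?V t x) z / (real L * pmf (bind_pmf ?P (?V t)) z)))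
        \<le> b t ^ k / sV t" if t: "t \<in> {1..T}" for t
    proof -
      have "expect (joint ?P (?V t)) (\<lambda>(x, z). ln (1 + pmf (?V t x) z / (real L * pmf (bind_pmf ?P (?V t)) z)))
        \<le> expect (joint ?P (?V t)) (\<lambda>x. exp (sV t * llr ?P (?V t) x + real k * (- sV t * lam)) / sV t)"
      proof (rule expect_mono[OF finJV'], clarify)
        fix x z assume xz: "(x, z) \<in> set_pmf (joint ?P (?V t))"
        note pos = set_joint_pos[OF xz]
        \<comment> \<open>Replacing \<open>L\<close> by the smaller exp (k * lam) only enlarges the
          argument of the logarithm, which then is 1 + exp w for a shifted information density
          w.\<close>
        define w where "w = llr ?P (?V t) (x, z) - real k * lam"
        have "exp w = pmf (?V t x) z / (exp (real k * lam) * pmf (bind_pmf ?P (?V t)) z)"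
          using pos by (simp add: w_def llr_def exp_diff)
        also have "\<dots> \<ge> pmf (?V t x) z / (real L * pmf (bind_pmf ?P (?V t)) z)"
          using pos Lb lam0 L1 by (intro divide_left_mono mult_right_mono mult_pos_pos) auto
        finally have "ln (1 + pmf (?V t x) z / (real L * pmf (bind_pmf ?P (?V t)) z)) \<le> ln (1 + exp w)"
          by (intro ln_mono) (auto intro!: add_pos_nonneg)
        also have "\<dots> \<le> exp (sV t * w) / sV t"
          by (rule ln_one_plus_exp_le) (use sV t in auto)
        finally show "ln (1 + pmf (?V t x) z / (real L * pmf (bind_pmf ?P (?V t)) z)) \<le>
            exp (sV t * llr ?P (?V t) (x, z) + real k * (- sV t * lam)) / sV t"
          by (simp add: w_def algebra_simps)
      qed
      also have "\<dots> = expect (joint ?P (?V t)) (\<lambda>x. exp (sV t * llr ?P (?V t) x + real k * (- sV t * lam))) / sV t"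
        by simp
      also have "\<dots> = b t ^ k / sV t"
        unfolding expect_exp_llr_iid[OF finp finV] b_def by (simp add: algebra_simps)
      finally show ?thesis .
    qed
    let ?\<epsilon> = "\<Sum>t\<in>{1..T}. measure_pmf.prob (joint ?P (?W t)) (- score_set T ?P ?W \<tau>)
      + 2 * real J * real L * (real T / \<tau>)
      + expect (joint ?P (?V t)) (\<lambda>(x, z). ln (1 + pmf (?V t x) z / (real L * pmf (bind_pmf ?P (?V t)) z)))"
    have le: "2 * ?\<epsilon> \<le> \<epsilon> k"
      unfolding \<epsilon>_def using A B C by (intro mult_left_mono sum_mono) (fastforce+)
    from one_shot_wiretap_code[where W = ?W and V = ?V and T = T, OF finP finW' finV' \<tau>0 J1 L1] obtain c D
      where cD: "\<forall>j\<in>{1..J}. \<forall>l\<in>{1..L}. c j l \<in> set_pmf ?P" "disjoint_family_on D {1..J}"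
      "\<forall>t\<in>{1..T}. \<forall>j\<in>{1..J}.
        (\<Sum>l\<in>{1..L}. measure_pmf.prob (?W t (c j l)) (- D j)) / real L \<le> 2 * ?\<epsilon> \<and>
        kl (bind_pmf (pmf_of_set {1..L}) (\<lambda>l. ?V t (c j l))) (bind_pmf ?P (?V t)) \<le> 2 * ?\<epsilon>"
      by blast
    have "?C L"
      unfolding J_def[symmetric] bind_iid[symmetric]
      using cD le by (intro exI[of _ c] exI[of _ D]) (meson order_trans)
    then show ?thesis using L1 by blast
  qed
  then show ?thesis using lim by blast
qed

subsection \<open>Joint distributions induced by auxiliary inputs and codes\<close>

text \<open>Disintegration: the auxiliary variable becomes a random letter in front of a stochastic
  encoder. The constant default word makes every \<open>E u\<close> a distribution on words of
  length n, also for values u of probability zero.\<close>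

lemma auxiliary_input_joint:
  assumes "auxiliary_input n Q"
  shows "\<exists>P E. Q = joint P E \<and> finite (set_pmf P) \<and> (\<forall>u. set_pmf (E u) \<subseteq> words n)"
proof -
  define P where "P = map_pmf fst Q"
  define E where "E u = (if u \<in> fst ` set_pmf Q then map_pmf snd (cond_pmf Q (fst -` {u}))
      else return_pmf (replicate n undefined))" for u
  have sub: "set_pmf (E u) \<subseteq> words n" for u
  proof (cases "u \<in> fst ` set_pmf Q")
    case True
    then have ne: "set_pmf Q \<inter> fst -` {u} \<noteq> {}" by auto
    have "snd ` set_pmf Q \<subseteq> words n" using assms by (simp add: auxiliary_input_def)
    then show ?thesis using True by (auto simp: E_def set_cond_pmf[OF ne])
  qed (simp add: E_def words_def)
  have "pmf Q (u, x) = pmf P u * pmf (E u) x" for u x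
  proof (cases "u \<in> fst ` set_pmf Q")
    case True
    then have ne: "set_pmf Q \<inter> fst -` {u} \<noteq> {}" by auto
    let ?M = "cond_pmf Q (fst -` {u})"
    have "pmf (map_pmf snd ?M) x = measure_pmf.prob ?M {(u, x)}"
      unfolding pmf_map by (intro measure_prob_cong_0) (auto simp: set_cond_pmf[OF ne] pmf_eq_0_set_pmf)
    also have "\<dots> = pmf Q (u, x) / measure_pmf.prob Q (fst -` {u})"
      by (simp add: measure_pmf_single pmf_cond[OF ne])
    also have "measure_pmf.prob Q (fst -` {u}) = pmf P u" by (simp add: P_def pmf_map)
    finally have "pmf (E u) x = pmf Q (u, x) / pmf P u" using True by (simp add: E_def)
    moreover have "pmf P u \<noteq> 0" using True by (simp add: P_def pmf_eq_0_set_pmf)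
    ultimately show ?thesis by simp
  next
    case False
    then have "pmf Q (u, x) = 0" "pmf P u = 0" by (force simp: pmf_eq_0_set_pmf P_def)+
    then show ?thesis by simp
  qed
  then have "Q = joint P E" by (intro pmf_eqI) (auto simp: pmf_joint)
  moreover have "finite (set_pmf P)" using assms by (simp add: auxiliary_input_def P_def)
  ultimately show ?thesis using sub by blast
qed

lemma output_joint_joint:
  "output_joint W (joint P E) = joint P (\<lambda>u. bind_pmf (E u) (memoryless_ext W))"
  by (simp add: output_joint_def joint_def bind_assoc_pmf bind_map_pmf map_bind_pmf)

lemma message_input_joint_alt: "message_input_joint J E = joint (pmf_of_set {1..J}) E"
  by (simp add: message_input_joint_def joint_def)

lemma set_encoded_words:
  assumes "set_pmf E \<subseteq> words n"
  shows "set_pmf (bind_pmf E (memoryless_ext W)) \<subseteq> words n"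
  using assms set_memoryless_ext_words[of W] by (fastforce simp: words_def)

lemma finite_set_encoded:
  fixes W :: "'a \<Rightarrow> 'b::finite pmf"
  assumes "set_pmf E \<subseteq> words n"
  shows "finite (set_pmf (bind_pmf E (memoryless_ext W)))"
  by (rule finite_subset[OF set_encoded_words[OF assms] finite_words])

lemma mutual_info_joint_nonneg:
  fixes P :: "'u::countable pmf" and K :: "'u \<Rightarrow> 'z::countable pmf"
  assumes fin: "finite (set_pmf P)" "\<forall>x\<in>set_pmf P. finite (set_pmf (K x))"
  shows "mutual_info (joint P K) \<ge> 0"
proof -
  have "expect P (\<lambda>_. 0) \<le> expect P (\<lambda>x. kl (K x) (bind_pmf P K))"
    using fin by (intro expect_mono kl_nonneg) auto
  then have "0 \<le> mutual_info (joint P K) * ln 2"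
    unfolding mutual_info_joint_kl[OF fin] by simp
  then show ?thesis by (simp add: zero_le_mult_iff)
qed

text \<open>The uniform distribution on words serves as reference in
  \<open>mutual_info_le_kl\<close>.\<close>

lemma mutual_info_joint_le_log_words:
  fixes P :: "'u::countable pmf" and K :: "'u \<Rightarrow> 'z::finite list pmf"
  assumes finP: "finite (set_pmf P)" and sub: "\<And>u. set_pmf (K u) \<subseteq> words n"
  shows "mutual_info (joint P K) \<le> real n * log 2 (real CARD('z))"
proof -
  let ?q = "pmf_of_set (words n :: 'z list set)"
  have ne: "(words n :: 'z list set) \<noteq> {}" by (auto simp: words_def intro: exI[of _ "replicate n undefined"])
  have card: "card (words n :: 'z list set) = CARD('z) ^ n"
    using card_lists_length_eq[of "UNIV :: 'z set" n] by (simp add: words_def)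
  have finK: "finite (set_pmf (K u))" for u by (rule finite_subset[OF sub finite_words])
  have kl_le: "kl (K u) ?q \<le> real n * ln (real CARD('z))" for u
  proof -
    have "kl (K u) ?q \<le> expect (K u) (\<lambda>_. real n * ln (real CARD('z)))"
      unfolding kl_def
    proof (rule expect_mono[OF finK])
      fix z assume z: "z \<in> set_pmf (K u)"
      then have zw: "z \<in> words n" using sub by blast
      have "pmf (K u) z > 0" using z by (rule pmf_positive)
      moreover have "pmf (K u) z \<le> 1" by (rule pmf_le_1)
      ultimately have "ln (pmf (K u) z * real (CARD('z) ^ n)) \<le> ln (real (CARD('z) ^ n))"
        by (subst ln_le_cancel_iff) auto
      also have "\<dots> = real n * ln (real CARD('z))" by (simp add: ln_realpow)
      finally show "ln (pmf (K u) z / pmf ?q z) \<le> real n * ln (real CARD('z))"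
        using zw by (simp add: pmf_of_set[OF ne finite_words] card)
    qed
    then show ?thesis by simp
  qed
  have "mutual_info (joint P K) * ln 2 \<le> expect P (\<lambda>u. kl (K u) ?q)"
    using finP finK sub by (intro mutual_info_le_kl) (auto simp: finite_words set_pmf_of_set[OF ne finite_words])
  also have "\<dots> \<le> expect P (\<lambda>_. real n * ln (real CARD('z)))"
    by (intro expect_mono finP kl_le)
  finally show ?thesis by (simp add: log_def field_simps)
qed

subsection \<open>Converse\<close>

text \<open>Fano's inequality, from the variational bound with the test function \<open>J / 2\<close> on the decoding
  set and \<open>1 / 2\<close> elsewhere.\<close>

lemma fano:
  fixes K :: "nat \<Rightarrow> 'z::countable pmf"
  assumes J: "J \<ge> 1" and finK: "\<And>j. j \<in> {1..J} \<Longrightarrow> finite (set_pmf (K j))"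
    and disj: "disjoint_family_on D {1..J}"
    and e: "\<And>j. j \<in> {1..J} \<Longrightarrow> measure_pmf.prob (K j) (- D j) \<le> e"
  shows "(1 - e) * ln (real J) - ln 2 \<le> mutual_info (joint (pmf_of_set {1..J}) K) * ln 2"
proof -
  let ?P = "pmf_of_set {1..J}"
  let ?m = "bind_pmf ?P K"
  have setP: "set_pmf ?P = {1..J}" using J by simp
  have finP: "finite (set_pmf ?P)" and finK': "\<forall>x\<in>set_pmf ?P. finite (set_pmf (K x))"
    using finK unfolding setP by auto
  have finm: "finite (set_pmf ?m)" by (rule finite_set_bind[OF finP finK'])
  have lnJ: "ln (real J) \<ge> 0" using J by simp
  have bound: "(1 - e) * ln (real J) - ln 2 + 1 / 2 - real J / 2 * measure_pmf.prob ?m (D j) \<le> kl (K j) ?m"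
    if j: "j \<in> {1..J}" for j
  proof -
    define f where "f y = (if y \<in> D j then real J / 2 else 1 / 2)" for y
    have fpos: "f y > 0" for y using J by (simp add: f_def)
    have sub: "set_pmf (K j) \<subseteq> set_pmf ?m" using j J by auto
    have "expect (K j) (\<lambda>y. ln (f y)) = expect (K j) (\<lambda>y. indicator (D j) y * ln (real J) - ln 2)"
      using J by (intro expect_cong) (auto simp: f_def ln_div split: split_indicator)
    also have "\<dots> = measure_pmf.prob (K j) (D j) * ln (real J) - ln 2"
      by (simp add: integrable_measure_pmf_finite[OF finK[OF j]])
    finally have 1: "expect (K j) (\<lambda>y. ln (f y)) = measure_pmf.prob (K j) (D j) * ln (real J) - ln 2" .
    have "measure_pmf.prob (K j) (- D j) = 1 - measure_pmf.prob (K j) (D j)"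
      using measure_pmf.prob_compl[of "D j" "K j"] by (simp add: Compl_eq_Diff_UNIV)
    then have "(1 - e) * ln (real J) \<le> measure_pmf.prob (K j) (D j) * ln (real J)"
      using e[OF j] lnJ by (intro mult_right_mono) auto
    moreover have "expect ?m f \<le> expect ?m (\<lambda>y. 1 / 2 + real J / 2 * indicator (D j) y)"
      by (intro expect_mono finm) (auto simp: f_def split: split_indicator)
    moreover have "expect ?m (\<lambda>y. 1 / 2 + real J / 2 * indicator (D j) y) =
        1 / 2 + real J / 2 * measure_pmf.prob ?m (D j)"
      by (subst expect_add[OF finm]) simp
    ultimately show ?thesis
      using kl_variational[of "K j" ?m f, OF finK[OF j] finm sub fpos] 1 by linarith
  qed
  \<comment> \<open>Disjoint decoding sets have total output probability at most one, so after
    averaging over messages the subtracted term is at most the surplus 1 / 2.\<close>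
  have "(\<Sum>j\<in>{1..J}. measure_pmf.prob ?m (D j)) = measure_pmf.prob ?m (\<Union>j\<in>{1..J}. D j)"
    using disj by (intro measure_pmf.finite_measure_finite_Union[symmetric]) auto
  then have "(\<Sum>j\<in>{1..J}. measure_pmf.prob ?m (D j)) \<le> 1" by simp
  then have "(1 - e) * ln (real J) - ln 2 \<le>
      ((\<Sum>j\<in>{1..J}. (1 - e) * ln (real J) - ln 2 + 1 / 2) - real J / 2 * (\<Sum>j\<in>{1..J}. measure_pmf.prob ?m (D j))) / real J"
    using J by (simp add: field_simps)
  also have "\<dots> = (\<Sum>j\<in>{1..J}. (1 - e) * ln (real J) - ln 2 + 1 / 2 - real J / 2 * measure_pmf.prob ?m (D j)) / real J"
    by (simp add: sum_subtractf sum_distrib_left)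
  also have "\<dots> \<le> (\<Sum>j\<in>{1..J}. kl (K j) ?m) / real J"
    using bound by (intro divide_right_mono sum_mono) auto
  also have "\<dots> = mutual_info (joint ?P K) * ln 2"
    unfolding mutual_info_joint_kl[OF finP finK'] by (rule expect_uniform[OF J, symmetric])
  finally show ?thesis .
qed

text \<open>All outputs have length n, so a complement within \<open>words n\<close> and one within
  all lists have the same probability.\<close>

lemma error_sum_eq_prob:
  fixes W :: "'a::finite \<Rightarrow> 'b::finite pmf"
  assumes E: "set_pmf E \<subseteq> words n"
  shows "(\<Sum>xs\<in>words n. pmf E xs * measure_pmf.prob (memoryless_ext W xs) (words n - D)) =
    measure_pmf.prob (bind_pmf E (memoryless_ext W)) (- D)"
proof -
  have finE: "finite (set_pmf E)" by (rule finite_subset[OF E finite_words])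
  have "(\<Sum>xs\<in>words n. pmf E xs * measure_pmf.prob (memoryless_ext W xs) (words n - D)) =
      expect E (\<lambda>xs. measure_pmf.prob (memoryless_ext W xs) (words n - D))"
    by (rule expect_sum_superset[OF finite_words E, symmetric])
  also have "\<dots> = measure_pmf.prob (bind_pmf E (memoryless_ext W)) (words n - D)"
    by (intro prob_bind[symmetric] finE ballI finite_subset[OF set_memoryless_ext_words finite_words])
  also have "\<dots> = measure_pmf.prob (bind_pmf E (memoryless_ext W)) (- D)"
    using set_encoded_words[OF E, of W] by (intro measure_prob_cong_0) (auto simp: pmf_eq_0_set_pmf)
  finally show ?thesis .
qed

lemma max_error_bounds:
  fixes W :: "nat \<Rightarrow> 'a::finite \<Rightarrow> 'b::finite pmf"
  assumes T: "T \<ge> 1" and code: "is_code n J E D"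
  shows "\<And>t j. t \<in> {1..T} \<Longrightarrow> j \<in> {1..J} \<Longrightarrow>
      measure_pmf.prob (bind_pmf (E j) (memoryless_ext (W t))) (- D j) \<le> max_error T W n J E D"
    and "(\<And>t j. t \<in> {1..T} \<Longrightarrow> j \<in> {1..J} \<Longrightarrow>
      measure_pmf.prob (bind_pmf (E j) (memoryless_ext (W t))) (- D j) \<le> e) \<Longrightarrow> max_error T W n J E D \<le> e"
    and "0 \<le> max_error T W n J E D"
proof -
  have J: "J \<ge> 1" using code by (simp add: is_code_def)
  define g where "g t j = measure_pmf.prob (bind_pmf (E j) (memoryless_ext (W t))) (- D j)" for t j
  have eq: "max_error T W n J E D = (MAX t\<in>{1..T}. MAX j\<in>{1..J}. g t j)"
    unfolding max_error_def
  proof (intro arg_cong[where f = Max] image_cong refl)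
    fix t j assume "j \<in> {1..J}"
    then have "set_pmf (E j) \<subseteq> words n" using code by (auto simp: is_code_def)
    then show "(\<Sum>xs\<in>words n. pmf (E j) xs * measure_pmf.prob (memoryless_ext (W t) xs) (words n - D j)) = g t j"
      unfolding g_def by (rule error_sum_eq_prob)
  qed
  show 1: "g t j \<le> max_error T W n J E D" if "t \<in> {1..T}" "j \<in> {1..J}" for t j
  proof -
    have "g t j \<le> (MAX j\<in>{1..J}. g t j)" using that by (intro Max_ge) auto
    also have "\<dots> \<le> max_error T W n J E D" unfolding eq using that by (intro Max_ge) auto
    finally show ?thesis .
  qed
  show "max_error T W n J E D \<le> e" if "\<And>t j. t \<in> {1..T} \<Longrightarrow> j \<in> {1..J} \<Longrightarrow> g t j \<le> e"
    unfolding eq using that T J by (subst Max_le_iff, simp, simp, clarify, subst Max_le_iff) auto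
  have "0 \<le> g 1 1" by (simp add: g_def)
  also have "\<dots> \<le> max_error T W n J E D" using T J by (intro 1) auto
  finally show "0 \<le> max_error T W n J E D" .
qed

lemma leakage_joint:
  "leakage T V J E = (MAX t\<in>{1..T}. mutual_info (joint (pmf_of_set {1..J}) (\<lambda>j. bind_pmf (E j) (memoryless_ext (V t)))))"
  by (simp add: leakage_def message_input_joint_alt output_joint_joint)

lemma leakage_nonneg:
  fixes V :: "nat \<Rightarrow> 'a::finite \<Rightarrow> 'c::finite pmf"
  assumes T: "T \<ge> 1" and J: "J \<ge> 1" and E: "\<And>j. j \<in> {1..J} \<Longrightarrow> set_pmf (E j) \<subseteq> words n"
  shows "0 \<le> leakage T V J E"
proof -
  have "0 \<le> mutual_info (joint (pmf_of_set {1..J}) (\<lambda>j. bind_pmf (E j) (memoryless_ext (V 1))))"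
  proof (rule mutual_info_joint_nonneg)
    have "set_pmf (pmf_of_set {1..J}) = {1..J}" using J by simp
    then show "finite (set_pmf (pmf_of_set {1..J}))"
      "\<forall>j\<in>set_pmf (pmf_of_set {1..J}). finite (set_pmf (bind_pmf (E j) (memoryless_ext (V 1))))"
      using finite_set_encoded E by (force simp del: set_bind_pmf)+
  qed
  also have "\<dots> \<le> leakage T V J E" unfolding leakage_joint using T by (intro Max_ge) auto
  finally show ?thesis .
qed

text \<open>The error is a maximum over states, so Fano's inequality holds for each of them and
  passes to the infimum. The leakage coincides with the subtracted supremum.\<close>

lemma code_objective:
  fixes W :: "nat \<Rightarrow> 'a::finite \<Rightarrow> 'b::finite pmf" and V :: "nat \<Rightarrow> 'a \<Rightarrow> 'c::finite pmf"
  assumes T: "T \<ge> 1" and code: "is_code n J E D"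
  shows "auxiliary_input n (message_input_joint J E)"
    and "(1 - max_error T W n J E D) * log 2 (real J) - 1 - leakage T V J E
      \<le> secrecy_objective T W V (message_input_joint J E)"
proof -
  let ?Q = "message_input_joint J E"
  let ?e = "max_error T W n J E D"
  have J: "J \<ge> 1" and sub: "\<And>j. j \<in> {1..J} \<Longrightarrow> set_pmf (E j) \<subseteq> words n"
    and disj: "disjoint_family_on D {1..J}" using code by (auto simp: is_code_def)
  have setP: "set_pmf (pmf_of_set {1..J}) = {1..J}" using J by simp
  have "fst ` set_pmf ?Q \<subseteq> {1..J}" "snd ` set_pmf ?Q \<subseteq> words n"
    using sub unfolding message_input_joint_alt set_joint setP by force+
  then show "auxiliary_input n ?Q" unfolding auxiliary_input_def using finite_subset by blast
  have "(1 - ?e) * log 2 (real J) - 1 \<le> mutual_info (output_joint (W t) ?Q)" if t: "t \<in> {1..T}" for t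
  proof -
    have "(1 - ?e) * ln (real J) - ln 2 \<le>
        mutual_info (joint (pmf_of_set {1..J}) (\<lambda>j. bind_pmf (E j) (memoryless_ext (W t)))) * ln 2"
      by (rule fano[OF J finite_set_encoded[OF sub] disj max_error_bounds(1)[OF T code t]])
    then show ?thesis
      by (simp add: message_input_joint_alt output_joint_joint log_def field_simps)
  qed
  then have "(1 - ?e) * log 2 (real J) - 1 \<le> (INF t\<in>{1..T}. mutual_info (output_joint (W t) ?Q))"
    using T by (intro cINF_greatest) auto
  moreover have "(SUP t\<in>{1..T}. mutual_info (output_joint (V t) ?Q)) = leakage T V J E"
    unfolding leakage_def using T by (intro cSup_eq_Max) auto
  ultimately show "(1 - ?e) * log 2 (real J) - 1 - leakage T V J E \<le> secrecy_objective T W V ?Q"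
    unfolding secrecy_objective_def by linarith
qed

text \<open>Shows in the end that achievable rates are bounded above, so that their supremum is
  meaningful.\<close>

lemma objective_le_log_card:
  fixes W :: "nat \<Rightarrow> 'a::finite \<Rightarrow> 'b::finite pmf" and V :: "nat \<Rightarrow> 'a \<Rightarrow> 'c::finite pmf"
  assumes T: "T \<ge> 1" and Q: "auxiliary_input n Q"
  shows "secrecy_objective T W V Q \<le> real n * log 2 (real CARD('b))"
proof -
  from auxiliary_input_joint[OF Q] obtain P E where PE: "Q = joint P E" "finite (set_pmf P)" "\<forall>u. set_pmf (E u) \<subseteq> words n"
    by blast
  have "(INF t\<in>{1..T}. mutual_info (output_joint (W t) Q)) \<le> mutual_info (output_joint (W 1) Q)"
    using T by (intro cINF_lower) auto
  also have "\<dots> \<le> real n * log 2 (real CARD('b))"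
    unfolding PE(1) output_joint_joint
    by (intro mutual_info_joint_le_log_words PE(2) set_encoded_words PE(3)[rule_format])
  finally have 1: "(INF t\<in>{1..T}. mutual_info (output_joint (W t) Q)) \<le> real n * log 2 (real CARD('b))" .
  have "0 \<le> mutual_info (output_joint (V 1) Q)"
    unfolding PE(1) output_joint_joint
    by (intro mutual_info_joint_nonneg PE(2) ballI finite_set_encoded[OF PE(3)[rule_format]])
  also have "\<dots> \<le> (SUP t\<in>{1..T}. mutual_info (output_joint (V t) Q))"
    using T by (intro cSUP_upper) auto
  finally show ?thesis using 1 unfolding secrecy_objective_def by linarith
qed

subsection \<open>Codes of arbitrary length from block codes\<close>

primrec chop :: "nat \<Rightarrow> nat \<Rightarrow> 'a list \<Rightarrow> 'a list list" where
  "chop 0 m ys = []"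
| "chop (Suc k) m ys = take m ys # chop k m (drop m ys)"

lemma chop_concat:
  "(\<And>xs. xs \<in> set xss \<Longrightarrow> length xs = m) \<Longrightarrow> chop (length xss) m (concat xss @ ys) = xss"
  by (induction xss) auto

lemma memoryless_ext_append:
  "memoryless_ext W (xs @ ys) = bind_pmf (memoryless_ext W xs) (\<lambda>a. map_pmf ((@) a) (memoryless_ext W ys))"
  by (induction xs)
    (simp_all add: bind_return_pmf bind_return_pmf' map_pmf_def pair_pmf_def bind_assoc_pmf)

text \<open>Encoding blockwise and then using the channel letter by letter amounts to a memoryless
  channel whose letters are the values u. The transmission of the first block commutes with the
  encoding of the later ones because the draws are independent.\<close>

lemma memoryless_ext_concat:
  "bind_pmf (memoryless_ext E us) (\<lambda>xss. memoryless_ext W (concat xss)) =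
    map_pmf concat (memoryless_ext (\<lambda>u. bind_pmf (E u) (memoryless_ext W)) us)"
proof (induction us)
  case (Cons u us)
  have "bind_pmf (memoryless_ext E (u # us)) (\<lambda>xss. memoryless_ext W (concat xss)) =
    bind_pmf (E u) (\<lambda>xs. bind_pmf (memoryless_ext E us) (\<lambda>xss.
      bind_pmf (memoryless_ext W xs) (\<lambda>a. map_pmf ((@) a) (memoryless_ext W (concat xss)))))"
    by (simp add: map_pmf_def pair_pmf_def bind_assoc_pmf bind_return_pmf memoryless_ext_append)
  also have "\<dots> = bind_pmf (E u) (\<lambda>xs. bind_pmf (memoryless_ext W xs) (\<lambda>a. map_pmf ((@) a)
      (bind_pmf (memoryless_ext E us) (\<lambda>xss. memoryless_ext W (concat xss)))))"
    unfolding map_bind_pmf by (subst bind_commute_pmf) simp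
  also have "\<dots> = map_pmf concat (memoryless_ext (\<lambda>u. bind_pmf (E u) (memoryless_ext W)) (u # us))"
    unfolding Cons.IH
    by (simp add: map_pmf_def pair_pmf_def bind_assoc_pmf bind_return_pmf)
  finally show ?case .
qed (simp add: bind_return_pmf)

section \<open>Stochastic block encoding followed by a constant tail\<close>

definition encode :: "('u \<Rightarrow> 'a list pmf) \<Rightarrow> 'a list \<Rightarrow> 'u list \<Rightarrow> 'a list pmf" where
  "encode E tail us = map_pmf (\<lambda>xss. concat xss @ tail) (memoryless_ext E us)"

definition append_tail :: "('a \<Rightarrow> 'b pmf) \<Rightarrow> 'a list \<Rightarrow> 'b list list \<Rightarrow> 'b list pmf" where
  "append_tail W tail yss = map_pmf ((@) (concat yss)) (memoryless_ext W tail)"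

lemma bind_encode:
  "bind_pmf (encode E tail us) (memoryless_ext W) =
    bind_pmf (memoryless_ext (\<lambda>u. bind_pmf (E u) (memoryless_ext W)) us) (append_tail W tail)"
proof -
  have "bind_pmf (encode E tail us) (memoryless_ext W) =
    bind_pmf (bind_pmf (memoryless_ext E us) (\<lambda>xss. memoryless_ext W (concat xss)))
      (\<lambda>a. map_pmf ((@) a) (memoryless_ext W tail))"
    by (simp add: encode_def bind_map_pmf memoryless_ext_append bind_assoc_pmf)
  then show ?thesis
    unfolding memoryless_ext_concat by (simp add: append_tail_def[abs_def] bind_map_pmf)
qed

lemma set_memoryless_ext_blocks:
  assumes "\<And>u. set_pmf (E u) \<subseteq> words m" "xss \<in> set_pmf (memoryless_ext E us)"
  shows "length xss = length us \<and> (\<forall>xs\<in>set xss. length xs = m)"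
  using assms(2)
proof (induction us arbitrary: xss)
  case (Cons u us)
  then obtain xs xss' where "xss = xs # xss'" "xs \<in> set_pmf (E u)" "xss' \<in> set_pmf (memoryless_ext E us)"
    by auto
  with Cons.IH[of xss'] assms(1)[of u] show ?case by (auto simp: words_def)
qed simp

lemma length_concat_blocks:
  "(\<forall>xs\<in>set xss. length xs = m) \<Longrightarrow> length (concat xss) = length xss * m"
  by (induction xss) auto

lemma set_encode:
  assumes "\<And>u. set_pmf (E u) \<subseteq> words m"
  shows "set_pmf (encode E tail us) \<subseteq> words (length us * m + length tail)"
proof
  fix xs assume "xs \<in> set_pmf (encode E tail us)"
  then obtain xss where xss: "xss \<in> set_pmf (memoryless_ext E us)" "xs = concat xss @ tail"
    by (auto simp: encode_def)
  have "length xss = length us \<and> (\<forall>xs\<in>set xss. length xs = m)"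
    by (rule set_memoryless_ext_blocks[where E = E, OF assms xss(1)])
  then show "xs \<in> words (length us * m + length tail)"
    using xss(2) length_concat_blocks[of xss m] by (simp add: words_def)
qed

definition block_encoder ::
  "nat \<Rightarrow> (nat \<Rightarrow> nat \<Rightarrow> 'u list) \<Rightarrow> ('u \<Rightarrow> 'a list pmf) \<Rightarrow> 'a list \<Rightarrow> nat \<Rightarrow> 'a list pmf" where
  "block_encoder L c E tail j = bind_pmf (pmf_of_set {1..L}) (\<lambda>l. encode E tail (c j l))"

lemma bind_block_encoder:
  "bind_pmf (block_encoder L c E tail j) (memoryless_ext W) =
    bind_pmf (bind_pmf (pmf_of_set {1..L})
      (\<lambda>l. memoryless_ext (\<lambda>u. bind_pmf (E u) (memoryless_ext W)) (c j l))) (append_tail W tail)"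
  by (simp add: block_encoder_def bind_assoc_pmf bind_encode)

text \<open>Every output is that of the block channel passed through \<open>append_tail\<close>, a
  kernel independent of the message. The receiver undoes it by \<open>chop\<close>; for the
  eavesdropper the i.i.d. reference is sent through the same kernel.\<close>

lemma block_encoder_code:
  fixes W :: "nat \<Rightarrow> 'a::finite \<Rightarrow> 'b::finite pmf" and V :: "nat \<Rightarrow> 'a \<Rightarrow> 'c::finite pmf"
    and E :: "'u \<Rightarrow> 'a list pmf" and tail :: "'a list"
  defines "W' \<equiv> \<lambda>t u. bind_pmf (E u) (memoryless_ext (W t))"
    and "V' \<equiv> \<lambda>t u. bind_pmf (E u) (memoryless_ext (V t))"
  assumes T: "T \<ge> 1" and J: "J \<ge> 1" and L: "L \<ge> 1" and finP: "finite (set_pmf P)"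
    and E: "\<And>u. set_pmf (E u) \<subseteq> words m" and n: "n = k * m + length tail"
    and c: "\<forall>j\<in>{1..J}. \<forall>l\<in>{1..L}. c j l \<in> set_pmf (iid k P)"
    and D: "disjoint_family_on D {1..J}"
    and bound: "\<forall>t\<in>{1..T}. \<forall>j\<in>{1..J}.
      (\<Sum>l\<in>{1..L}. measure_pmf.prob (memoryless_ext (W' t) (c j l)) (- D j)) / real L \<le> e \<and>
      kl (bind_pmf (pmf_of_set {1..L}) (\<lambda>l. memoryless_ext (V' t) (c j l))) (iid k (bind_pmf P (V' t))) \<le> e"
  shows "\<exists>E' D'. is_code n J E' D' \<and> max_error T W n J E' D' \<le> e \<and> leakage T V J E' \<le> e / ln 2"
proof -
  let ?E = "block_encoder L c E tail"
  let ?D = "\<lambda>j. {ys \<in> words n. chop k m ys \<in> D j}"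
  have setL: "set_pmf (pmf_of_set {1..L}) = {1..L}" and setJ: "set_pmf (pmf_of_set {1..J}) = {1..J}"
    using L J by simp_all
  have finL: "finite (set_pmf (pmf_of_set {1..L}))" and finJ: "finite (set_pmf (pmf_of_set {1..J}))"
    unfolding setL setJ by simp_all
  have lenc: "length (c j l) = k" if "j \<in> {1..J}" "l \<in> {1..L}" for j l
    using c that set_iid by blast
  have E': "set_pmf (?E j) \<subseteq> words n" if "j \<in> {1..J}" for j
  proof -
    have "set_pmf (encode E tail (c j l)) \<subseteq> words n" if "l \<in> {1..L}" for l
      using set_encode[where E = E and tail = tail and us = "c j l", OF E] lenc[OF \<open>j \<in> {1..J}\<close> that]
      by (simp add: n)
    then show ?thesis unfolding block_encoder_def set_bind_pmf setL by blast
  qed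
  have code: "is_code n J ?E ?D"
  proof -
    have "disjoint_family_on ?D {1..J}" using D unfolding disjoint_family_on_def by blast
    moreover have "?D j \<subseteq> words n" for j by blast
    ultimately show ?thesis unfolding is_code_def using J E' by blast
  qed
  have W'words: "set_pmf (W' t u) \<subseteq> words m" and V'words: "set_pmf (V' t u) \<subseteq> words m" for t u
    unfolding W'_def V'_def by (rule set_encoded_words[OF E])+
  have finW': "finite (set_pmf (W' t u))" and finV': "finite (set_pmf (V' t u))" for t u
    using finite_subset[OF W'words finite_words] finite_subset[OF V'words finite_words] by auto
  have err: "measure_pmf.prob (bind_pmf (?E j) (memoryless_ext (W t))) (- ?D j) \<le> e"
    if t: "t \<in> {1..T}" and j: "j \<in> {1..J}" for t j
  proof -
    let ?K = "bind_pmf (pmf_of_set {1..L}) (\<lambda>l. memoryless_ext (W' t) (c j l))"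
    have finK: "finite (set_pmf ?K)"
      by (intro finite_set_bind finL ballI finite_set_memoryless_ext finW')
    have "measure_pmf.prob (bind_pmf (?E j) (memoryless_ext (W t))) (- ?D j) =
        expect ?K (\<lambda>yss. measure_pmf.prob (append_tail (W t) tail yss) (- ?D j))"
      unfolding bind_block_encoder W'_def
      by (rule prob_bind[OF finK[unfolded W'_def]])
        (auto simp: append_tail_def intro!: finite_imageI finite_subset[OF set_memoryless_ext_words finite_words])
    also have "\<dots> \<le> expect ?K (indicator (- D j))"
    proof (rule expect_mono[OF finK])
      fix yss assume "yss \<in> set_pmf ?K"
      then obtain l where l: "l \<in> {1..L}" "yss \<in> set_pmf (memoryless_ext (W' t) (c j l))"
        unfolding set_bind_pmf setL by blast
      from set_memoryless_ext_blocks[where E = "W' t", OF W'words l(2)] lenc[OF j l(1)]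
      have yss: "length yss = k" "\<forall>xs\<in>set yss. length xs = m" by auto
      \<comment> \<open>Once the blocks lie in the decoding set, no tail output can cause an
        error.\<close>
      show "measure_pmf.prob (append_tail (W t) tail yss) (- ?D j) \<le> indicator (- D j) yss"
      proof (cases "yss \<in> D j")
        case True
        have "set_pmf (append_tail (W t) tail yss) \<subseteq> ?D j"
        proof
          fix ys assume "ys \<in> set_pmf (append_tail (W t) tail yss)"
          then obtain zs where zs: "zs \<in> set_pmf (memoryless_ext (W t) tail)" "ys = concat yss @ zs"
            by (auto simp: append_tail_def)
          have "length zs = length tail"
            using zs(1) set_memoryless_ext_words[of "W t" tail] by (auto simp: words_def)
          then have "ys \<in> words n"
            using zs(2) yss length_concat_blocks[OF yss(2)] by (simp add: words_def n)
          moreover have "chop k m ys = yss"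
            using chop_concat[of yss m zs] yss zs(2) by simp
          ultimately show "ys \<in> ?D j" using True by simp
        qed
        then have "measure_pmf.prob (append_tail (W t) tail yss) (- ?D j) = 0"
          by (auto simp: measure_pmf_zero_iff)
        then show ?thesis by simp
      qed simp
    qed
    also have "\<dots> = measure_pmf.prob ?K (- D j)" by simp
    also have "\<dots> = expect (pmf_of_set {1..L}) (\<lambda>l. measure_pmf.prob (memoryless_ext (W' t) (c j l)) (- D j))"
      by (intro prob_bind finL ballI finite_set_memoryless_ext finW')
    also have "\<dots> \<le> e" unfolding expect_uniform[OF L] using bound t j by blast
    finally show ?thesis .
  qed
  have "max_error T W n J ?E ?D \<le> e"
    by (rule max_error_bounds(2)[OF T code err])
  moreover have "leakage T V J ?E \<le> e / ln 2"
  proof -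
    have "mutual_info (joint (pmf_of_set {1..J}) (\<lambda>j. bind_pmf (?E j) (memoryless_ext (V t)))) \<le> e / ln 2"
      if t: "t \<in> {1..T}" for t
    proof -
      let ?r = "iid k (bind_pmf P (V' t))"
      let ?K = "\<lambda>j. bind_pmf (pmf_of_set {1..L}) (\<lambda>l. memoryless_ext (V' t) (c j l))"
      let ?G = "append_tail (V t) tail"
      have finr: "finite (set_pmf ?r)"
        by (intro finite_set_iid finite_set_bind finP ballI finV')
      have finG: "finite (set_pmf (?G yss))" for yss
        by (auto simp: append_tail_def intro!: finite_imageI finite_subset[OF set_memoryless_ext_words finite_words])
      have sub: "set_pmf (?K j) \<subseteq> set_pmf ?r" if "j \<in> {1..J}" for j
        unfolding bind_iid[symmetric] set_bind_pmf setL using c that by blast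
      have subG: "set_pmf (bind_pmf (?K j) ?G) \<subseteq> set_pmf (bind_pmf ?r ?G)" if "j \<in> {1..J}" for j
        unfolding set_bind_pmf[of _ ?G] using sub[OF that] by blast
      have finrG: "finite (set_pmf (bind_pmf ?r ?G))"
        by (intro finite_set_bind finr ballI finG)
      have eq: "bind_pmf (?E j) (memoryless_ext (V t)) = bind_pmf (?K j) ?G" for j
        unfolding bind_block_encoder V'_def ..
      have "mutual_info (joint (pmf_of_set {1..J}) (\<lambda>j. bind_pmf (?K j) ?G)) * ln 2 \<le>
          expect (pmf_of_set {1..J}) (\<lambda>j. kl (bind_pmf (?K j) ?G) (bind_pmf ?r ?G))"
      proof (rule mutual_info_le_kl[OF finJ _ finrG])
        show "\<forall>j\<in>set_pmf (pmf_of_set {1..J}). finite (set_pmf (bind_pmf (?K j) ?G))"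
          unfolding setJ using finite_subset[OF subG finrG] by blast
        show "set_pmf (bind_pmf (?K j) ?G) \<subseteq> set_pmf (bind_pmf ?r ?G)"
          if "j \<in> set_pmf (pmf_of_set {1..J})" for j
          using that subG unfolding setJ by blast
      qed
      also have "\<dots> \<le> expect (pmf_of_set {1..J}) (\<lambda>j. e)"
      proof (rule expect_mono[OF finJ])
        fix j assume "j \<in> set_pmf (pmf_of_set {1..J})"
        then have j: "j \<in> {1..J}" unfolding setJ .
        have "kl (bind_pmf (?K j) ?G) (bind_pmf ?r ?G) \<le> kl (?K j) ?r"
          using finite_subset[OF sub[OF j] finr] finG by (intro kl_data_processing finr sub j) auto
        also have "\<dots> \<le> e" using bound t j by blast
        finally show "kl (bind_pmf (?K j) ?G) (bind_pmf ?r ?G) \<le> e" .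
      qed
      finally show ?thesis unfolding eq by (simp add: field_simps)
    qed
    then show ?thesis unfolding leakage_joint using T by (subst Max_le_iff) auto
  qed
  ultimately show ?thesis using code by blast
qed

subsection \<open>Achievability\<close>

text \<open>A single message is decoded without error and leaks nothing. This makes the set of
  achievable rates nonempty and the capacity nonnegative.\<close>

lemma achievable_zero:
  fixes W :: "nat \<Rightarrow> 'a::finite \<Rightarrow> 'b::finite pmf" and V :: "nat \<Rightarrow> 'a \<Rightarrow> 'c::finite pmf"
  assumes T: "T \<ge> 1"
  shows "achievable_secrecy_rate T W V 0"
proof -
  define E :: "nat \<Rightarrow> nat \<Rightarrow> 'a list pmf" where "E n j = return_pmf (replicate n undefined)" for n j
  define D :: "nat \<Rightarrow> nat \<Rightarrow> 'b list set" where "D n j = words n" for n j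
  have code: "is_code n 1 (E n) (D n)" for n
    by (auto simp: is_code_def E_def D_def words_def disjoint_family_on_def)
  have "max_error T W n 1 (E n) (D n) = 0" for n
  proof (rule antisym)
    show "max_error T W n 1 (E n) (D n) \<le> 0"
    proof (rule max_error_bounds(2)[OF T code])
      fix t j
      have "set_pmf (bind_pmf (E n j) (memoryless_ext (W t))) \<subseteq> D n j"
        unfolding D_def by (rule set_encoded_words) (simp add: E_def words_def)
      then have "measure_pmf.prob (bind_pmf (E n j) (memoryless_ext (W t))) (- D n j) = 0"
        by (auto simp: measure_pmf_zero_iff simp del: set_bind_pmf)
      then show "measure_pmf.prob (bind_pmf (E n j) (memoryless_ext (W t))) (- D n j) \<le> 0" by simp
    qed
  qed (rule max_error_bounds(3)[OF T code])
  moreover have "leakage T V 1 (E n) = 0" for n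
  proof -
    have E1: "set_pmf (E n j) \<subseteq> words n" for j by (simp add: E_def words_def)
    have s1: "set_pmf (pmf_of_set {1..1::nat}) = {1}" by simp
    have "mutual_info (joint (pmf_of_set {1..1}) (\<lambda>j. bind_pmf (E n j) (memoryless_ext (V t)))) = 0" for t
    proof -
      have fin: "finite (set_pmf (bind_pmf (E n j) (memoryless_ext (V t))))" for j
        by (rule finite_set_encoded[OF E1])
      have "mutual_info (joint (pmf_of_set {1..1}) (\<lambda>j. bind_pmf (E n j) (memoryless_ext (V t)))) * ln 2
        \<le> expect (pmf_of_set {1..1::nat}) (\<lambda>j. kl (bind_pmf (E n j) (memoryless_ext (V t))) (bind_pmf (E n 1) (memoryless_ext (V t))))"
        by (rule mutual_info_le_kl) (use fin in \<open>auto simp: E_def\<close>)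
      also have "\<dots> = kl (bind_pmf (E n 1) (memoryless_ext (V t))) (bind_pmf (E n 1) (memoryless_ext (V t)))"
        by (subst expect_uniform) auto
      also have "\<dots> = expect (bind_pmf (E n 1) (memoryless_ext (V t))) (\<lambda>_. 0)"
        unfolding kl_def by (intro expect_cong) (auto simp: pmf_eq_0_set_pmf)
      finally have "mutual_info (joint (pmf_of_set {1..1}) (\<lambda>j. bind_pmf (E n j) (memoryless_ext (V t)))) \<le> 0"
        by (simp add: mult_le_0_iff)
      moreover have "mutual_info (joint (pmf_of_set {1..1}) (\<lambda>j. bind_pmf (E n j) (memoryless_ext (V t)))) \<ge> 0"
        by (rule mutual_info_joint_nonneg) (use fin in auto)
      ultimately show ?thesis by simp
    qed
    then have "leakage T V 1 (E n) = Max ((\<lambda>_. 0) ` {1..T})" unfolding leakage_joint by simp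
    also have "\<dots> = 0" using T by (simp add: image_constant_conv)
    finally show ?thesis .
  qed
  moreover have "liminf (\<lambda>n. ereal (log 2 (real 1) / real n)) \<ge> ereal 0"
    by (simp add: zero_ereal_def[symmetric] Liminf_const)
  ultimately show ?thesis
    unfolding achievable_secrecy_rate_def using code
    by (intro conjI exI[of _ "\<lambda>_. 1"] exI[of _ E] exI[of _ D]) auto
qed

lemma div_at_top: "m \<ge> 1 \<Longrightarrow> filterlim (\<lambda>n::nat. n div m) sequentially sequentially"
  unfolding filterlim_at_top
proof
  fix Z :: nat assume "m \<ge> 1"
  then show "\<forall>\<^sub>F n in sequentially. Z \<le> n div m"
    by (intro eventually_sequentiallyI[of "Z * m"]) (simp add: less_eq_div_iff_mult_less_eq)
qed

lemma achievable_below_objective: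
  fixes W :: "nat \<Rightarrow> 'a::finite \<Rightarrow> 'b::finite pmf" and V :: "nat \<Rightarrow> 'a \<Rightarrow> 'c::finite pmf"
  assumes T: "T \<ge> 1" and m: "m \<ge> 1" and Q: "auxiliary_input m Q"
    and R: "R \<ge> 0" "real m * R < secrecy_objective T W V Q"
  shows "achievable_secrecy_rate T W V R"
proof -
  from auxiliary_input_joint[OF Q] obtain P E where QPE: "Q = joint P E" and finP: "finite (set_pmf P)"
    and E: "\<And>u. set_pmf (E u) \<subseteq> words m"
    by blast
  \<comment> \<open>The rate in nats carried by one block of \<open>m\<close> letters.\<close>
  define \<rho> where "\<rho> = real m * R * ln 2"
  define W' where "W' t u = bind_pmf (E u) (memoryless_ext (W t))" for t u
  define V' where "V' t u = bind_pmf (E u) (memoryless_ext (V t))" for t u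
  have finW': "finite (set_pmf (W' t u))" and finV': "finite (set_pmf (V' t u))" for t u
    unfolding W'_def V'_def by (rule finite_set_encoded[OF E])+
  have iW: "mutual_info (output_joint (W t) Q) * ln 2 = expect (joint P (W' t)) (llr P (W' t))" for t
    unfolding QPE output_joint_joint W'_def[symmetric, abs_def]
    using mutual_info_joint[of P "W' t"] finP finW' by (simp add: llr_def)
  have iV: "mutual_info (output_joint (V t) Q) * ln 2 = expect (joint P (V' t)) (llr P (V' t))" for t
    unfolding QPE output_joint_joint V'_def[symmetric, abs_def]
    using mutual_info_joint[of P "V' t"] finP finV' by (simp add: llr_def)
  have gap: "\<rho> < expect (joint P (W' t)) (llr P (W' t)) - expect (joint P (V' t')) (llr P (V' t'))"
    if t: "t \<in> {1..T}" and t': "t' \<in> {1..T}" for t t'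
  proof -
    have "(INF t\<in>{1..T}. mutual_info (output_joint (W t) Q)) \<le> mutual_info (output_joint (W t) Q)"
      using t by (intro cINF_lower) auto
    moreover have "mutual_info (output_joint (V t') Q) \<le> (SUP t\<in>{1..T}. mutual_info (output_joint (V t) Q))"
      using t' by (intro cSUP_upper) auto
    ultimately have "real m * R < mutual_info (output_joint (W t) Q) - mutual_info (output_joint (V t') Q)"
      using R(2) unfolding secrecy_objective_def by linarith
    then have "real m * R * ln 2 < (mutual_info (output_joint (W t) Q) - mutual_info (output_joint (V t') Q)) * ln 2"
      by (intro mult_strict_right_mono) auto
    then show ?thesis by (simp add: \<rho>_def left_diff_distrib iW iV)
  qed
  have \<rho>0: "\<rho> \<ge> 0" using R by (simp add: \<rho>_def)
  define J where "J n = nat \<lceil>exp (real (n div m) * \<rho>)\<rceil>" for n :: nat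
  note Jb = nat_ceiling_exp_bounds[of "real (n div m) * \<rho>" for n, folded J_def]
  obtain \<epsilon> where \<epsilon>: "\<epsilon> \<longlonglongrightarrow> 0" and codes: "\<And>k. \<exists>L\<ge>1. \<exists>c D.
    (\<forall>j\<in>{1..nat \<lceil>exp (real k * \<rho>)\<rceil>}. \<forall>l\<in>{1..L}. c j l \<in> set_pmf (iid k P)) \<and>
    disjoint_family_on D {1..nat \<lceil>exp (real k * \<rho>)\<rceil>} \<and>
    (\<forall>t\<in>{1..T}. \<forall>j\<in>{1..nat \<lceil>exp (real k * \<rho>)\<rceil>}.
      (\<Sum>l\<in>{1..L}. measure_pmf.prob (memoryless_ext (W' t) (c j l)) (- D j)) / real L \<le> \<epsilon> k \<and>
      kl (bind_pmf (pmf_of_set {1..L}) (\<lambda>l. memoryless_ext (V' t) (c j l))) (iid k (bind_pmf P (V' t))) \<le> \<epsilon> k)"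
    using block_wiretap_codes[where W = W' and V = V', OF finP finW' finV' T \<rho>0 gap] by blast
  have "\<exists>E' D'. is_code n (J n) E' D' \<and> max_error T W n (J n) E' D' \<le> \<epsilon> (n div m) \<and>
      leakage T V (J n) E' \<le> \<epsilon> (n div m) / ln 2" for n
  proof -
    from codes[of "n div m"] obtain L c D where L: "L \<ge> 1"
      and c: "\<forall>j\<in>{1..J n}. \<forall>l\<in>{1..L}. c j l \<in> set_pmf (iid (n div m) P)"
      and D: "disjoint_family_on D {1..J n}"
      and b: "\<forall>t\<in>{1..T}. \<forall>j\<in>{1..J n}.
        (\<Sum>l\<in>{1..L}. measure_pmf.prob (memoryless_ext (W' t) (c j l)) (- D j)) / real L \<le> \<epsilon> (n div m) \<and>
        kl (bind_pmf (pmf_of_set {1..L}) (\<lambda>l. memoryless_ext (V' t) (c j l))) (iid (n div m) (bind_pmf P (V' t))) \<le> \<epsilon> (n div m)"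
      unfolding J_def[symmetric] by blast
    have n: "n = (n div m) * m + length (replicate (n mod m) (undefined :: 'a))" by simp
    have J1: "J n \<ge> 1" using Jb(3) \<rho>0 by simp
    show ?thesis
      using block_encoder_code[where E = E and W = W and V = V, OF T J1 L finP E n c D b[unfolded W'_def V'_def]]
      by blast
  qed
  then obtain E' D' where code: "\<And>n. is_code n (J n) (E' n) (D' n)"
    and err: "\<And>n. max_error T W n (J n) (E' n) (D' n) \<le> \<epsilon> (n div m)"
    and leak: "\<And>n. leakage T V (J n) (E' n) \<le> \<epsilon> (n div m) / ln 2"
    by metis
  have lim: "(\<lambda>n. \<epsilon> (n div m)) \<longlonglongrightarrow> 0"
    by (rule filterlim_compose[OF \<epsilon> div_at_top[OF m]])
  have "(\<lambda>n. max_error T W n (J n) (E' n) (D' n)) \<longlonglongrightarrow> 0"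
    by (rule tendsto_sandwich[OF _ _ tendsto_const lim])
      (use max_error_bounds(3)[OF T code] err in \<open>auto intro!: always_eventually\<close>)
  moreover have "(\<lambda>n. leakage T V (J n) (E' n)) \<longlonglongrightarrow> 0"
  proof (rule tendsto_sandwich[OF _ _ tendsto_const])
    show "(\<lambda>n. \<epsilon> (n div m) / ln 2) \<longlonglongrightarrow> 0"
      using tendsto_divide[OF lim tendsto_const, of "ln 2"] by simp
    show "\<forall>\<^sub>F n in sequentially. 0 \<le> leakage T V (J n) (E' n)"
    proof (intro always_eventually allI)
      fix n
      have "J n \<ge> 1" "\<And>j. j \<in> {1..J n} \<Longrightarrow> set_pmf (E' n j) \<subseteq> words n"
        using code[of n] unfolding is_code_def by blast+
      then show "0 \<le> leakage T V (J n) (E' n)" by (rule leakage_nonneg[OF T])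
    qed
    show "\<forall>\<^sub>F n in sequentially. leakage T V (J n) (E' n) \<le> \<epsilon> (n div m) / ln 2"
      using leak by (intro always_eventually) auto
  qed
  moreover have "liminf (\<lambda>n. ereal (log 2 (real (J n)) / real n)) \<ge> ereal R"
  proof -
    \<comment> \<open>Fewer than \<open>m\<close> letters fall outside the blocks, which costs at
      most \<open>m * R\<close> bits.\<close>
    have "(\<lambda>n. R - real m * R / real n) \<longlonglongrightarrow> R" by real_asymp
    then have "liminf (\<lambda>n. ereal (R - real m * R / real n)) = ereal R"
      by (intro lim_imp_Liminf) auto
    moreover have "liminf (\<lambda>n. ereal (R - real m * R / real n)) \<le> liminf (\<lambda>n. ereal (log 2 (real (J n)) / real n))"
    proof (rule Liminf_mono, rule eventually_sequentiallyI[of 1])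
      fix n :: nat assume n: "n \<ge> 1"
      have "ln (exp (real (n div m) * \<rho>)) \<le> ln (real (J n))"
        using Jb(1)[of n] \<rho>0 by (intro ln_mono) auto
      then have "real (n div m) * \<rho> / ln 2 \<le> log 2 (real (J n))"
        by (simp add: log_def divide_right_mono)
      then have 1: "real (n div m) * (real m * R) \<le> log 2 (real (J n))"
        by (simp add: \<rho>_def)
      have "n \<le> (n div m) * m + m"
        using m mod_less_divisor[of m n] div_mult_mod_eq[of n m] by linarith
      then have "real n \<le> real (n div m) * real m + real m"
        by (metis of_nat_add of_nat_le_iff of_nat_mult)
      from mult_right_mono[OF this R(1)] have "real n * R - real m * R \<le> real (n div m) * (real m * R)"
        by (simp add: algebra_simps)
      then have "R * real n - real m * R \<le> log 2 (real (J n))" using 1 by (simp add: mult.commute)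
      then show "ereal (R - real m * R / real n) \<le> ereal (log 2 (real (J n)) / real n)"
        using n divide_right_mono[of "R * real n - real m * R" "log 2 (real (J n))" "real n"]
        by (simp add: diff_divide_distrib)
    qed
    ultimately show ?thesis by simp
  qed
  ultimately show ?thesis
    unfolding achievable_secrecy_rate_def using R(1) code by blast
qed

subsection \<open>The capacity formula\<close>

lemma achievable_eventually_le:
  fixes W :: "nat \<Rightarrow> 'a::finite \<Rightarrow> 'b::finite pmf" and V :: "nat \<Rightarrow> 'a \<Rightarrow> 'c::finite pmf"
  assumes T: "T \<ge> 1" and R: "achievable_secrecy_rate T W V R" and R': "R' < R"
  shows "\<forall>\<^sub>F n in sequentially. \<exists>Q. auxiliary_input n Q \<and> real n * R' < secrecy_objective T W V Q"
proof -
  from R obtain J E D where code: "\<And>n. is_code n (J n) (E n) (D n)"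
    and err: "(\<lambda>n. max_error T W n (J n) (E n) (D n)) \<longlonglongrightarrow> 0"
    and rate: "ereal R \<le> liminf (\<lambda>n. ereal (log 2 (real (J n)) / real n))"
    and leak: "(\<lambda>n. leakage T V (J n) (E n)) \<longlonglongrightarrow> 0"
    unfolding achievable_secrecy_rate_def by blast
  let ?e = "\<lambda>n. max_error T W n (J n) (E n) (D n)" and ?l = "\<lambda>n. leakage T V (J n) (E n)"
  \<comment> \<open>An intermediate rate: the limit inferior yields a strict bound for
    \<open>R2\<close> from some n on, and the vanishing Fano and leakage losses fit into the
    distance from \<open>R2\<close> to \<open>R'\<close>.\<close>
  define R2 where "R2 = (R' + R) / 2"
  have R2: "R' < R2" "R2 < R" using R' by (simp_all add: R2_def)
  have "ereal R2 < liminf (\<lambda>n. ereal (log 2 (real (J n)) / real n))"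
    using rate R2(2) by (meson ereal_less(2) less_ereal.simps(1) less_le_trans)
  then have ev1: "\<forall>\<^sub>F n in sequentially. ereal R2 < ereal (log 2 (real (J n)) / real n)"
    by (rule less_LiminfD)
  \<comment> \<open>Keeps the factor \<open>1 - ?e n\<close> positive, so that the rate bound may be
    multiplied by it.\<close>
  have ev2: "\<forall>\<^sub>F n in sequentially. ?e n < 1" using err by (rule order_tendstoD) simp
  have "(\<lambda>n. (1 - ?e n) * R2 - (1 + ?l n) / real n) \<longlonglongrightarrow> (1 - 0) * R2 - 0"
  proof (intro tendsto_diff tendsto_mult tendsto_const err)
    have "(\<lambda>n. (1 + ?l n) * inverse (real n)) \<longlonglongrightarrow> (1 + 0) * 0"
      by (intro tendsto_mult tendsto_add tendsto_const leak lim_inverse_n)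
    then show "(\<lambda>n. (1 + ?l n) / real n) \<longlonglongrightarrow> 0" by (simp add: divide_inverse)
  qed
  then have ev3: "\<forall>\<^sub>F n in sequentially. R' < (1 - ?e n) * R2 - (1 + ?l n) / real n"
    using R2(1) by (intro order_tendstoD) auto
  from ev1 ev2 ev3 eventually_ge_at_top[of 1] show ?thesis
  proof eventually_elim
    case (elim n)
    have "(1 - ?e n) * R2 \<le> (1 - ?e n) * (log 2 (real (J n)) / real n)"
      using elim by (intro mult_left_mono) auto
    with elim have "R' < (1 - ?e n) * (log 2 (real (J n)) / real n) - (1 + ?l n) / real n" by linarith
    then have "real n * R' < real n * ((1 - ?e n) * (log 2 (real (J n)) / real n) - (1 + ?l n) / real n)"
      using elim by (intro mult_strict_left_mono) auto
    also have "\<dots> = (1 - ?e n) * log 2 (real (J n)) - 1 - ?l n"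
      using elim by (simp add: right_diff_distrib)
    also have "\<dots> \<le> secrecy_objective T W V (message_input_joint (J n) (E n))"
      by (rule code_objective(2)[OF T code])
    finally show ?case using code_objective(1)[OF T code] by blast
  qed
qed

theorem mainTheorem3:
  fixes T :: nat
    and W :: "nat \<Rightarrow> 'a::finite \<Rightarrow> 'b::finite pmf"
    and V :: "nat \<Rightarrow> 'a \<Rightarrow> 'c::finite pmf"
  assumes "T \<ge> 1"
  shows "\<exists>M :: nat \<Rightarrow> real.
    (\<forall>n\<ge>1. \<exists>Q. is_arg_max (secrecy_objective T W V) (auxiliary_input n) Q \<and>
               M n = secrecy_objective T W V Q) \<and>
    (\<lambda>n. (1 / real n) * M n) \<longlonglongrightarrow> secrecy_capacity T W V"
proof -
  let ?A = "{R. achievable_secrecy_rate T W V R}"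
  obtain Q where Q: "\<And>n. is_arg_max (secrecy_objective T W V) (auxiliary_input n) (Q n)"
    using arg_max_auxiliary_input[OF assms, of W V] by metis
  define M where "M n = secrecy_objective T W V (Q n)" for n
  have aux: "auxiliary_input n (Q n)" and max: "auxiliary_input n Q' \<Longrightarrow> secrecy_objective T W V Q' \<le> M n"
    for n Q'
    using Q[of n] by (auto simp: is_arg_max_linorder M_def)
  have zero: "0 \<in> ?A" using achievable_zero[OF assms] by simp
  \<comment> \<open>A larger achievable rate would force, for some n, an objective beyond its
    cardinality bound.\<close>
  have "R \<le> log 2 (real CARD('b))" if "R \<in> ?A" for R
  proof (rule ccontr)
    assume "\<not> ?thesis"
    then have "log 2 (real CARD('b)) < R" by simp
    from achievable_eventually_le[OF assms _ this, of W V] that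
    obtain n Q' where "auxiliary_input n Q'" "real n * log 2 (real CARD('b)) < secrecy_objective T W V Q'"
      by (auto dest!: eventually_happens)
    with objective_le_log_card[OF assms, of n Q' W V] show False by simp
  qed
  then have bdd: "bdd_above ?A" by (rule bdd_aboveI)
  have C0: "0 \<le> secrecy_capacity T W V"
    unfolding secrecy_capacity_def by (rule cSup_upper[OF zero bdd])
  have upper: "1 / real n * M n \<le> secrecy_capacity T W V" if n: "n \<ge> 1" for n
  proof (rule dense_le)
    fix R assume R: "R < 1 / real n * M n"
    show "R \<le> secrecy_capacity T W V"
    \<comment> \<open>Achievable rates are nonnegative by definition, so a negative \<open>R\<close>
      is handled by nonnegativity of the capacity; the objective itself may be negative a
      priori.\<close>
    proof (cases "R \<ge> 0")
      case True
      have "real n * R < M n" using R n by (simp add: field_simps)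
      then have "R \<in> ?A"
        using achievable_below_objective[OF assms n aux True] by (simp add: M_def)
      then show ?thesis unfolding secrecy_capacity_def by (rule cSup_upper[OF _ bdd])
    qed (use C0 in linarith)
  qed
  have "(\<lambda>n. 1 / real n * M n) \<longlonglongrightarrow> secrecy_capacity T W V"
  proof (rule order_tendstoI)
    fix a assume a: "a < secrecy_capacity T W V"
    from a zero obtain R where "R \<in> ?A" "a < R"
      unfolding secrecy_capacity_def by (auto elim: less_cSupE)
    with achievable_eventually_le[OF assms, of W V R a]
    have "\<forall>\<^sub>F n in sequentially. \<exists>Q. auxiliary_input n Q \<and> real n * a < secrecy_objective T W V Q" by simp
    with eventually_ge_at_top[of 1] show "\<forall>\<^sub>F n in sequentially. a < 1 / real n * M n"
    proof eventually_elim
      case (elim n)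
      then have "real n * a < M n" using max[of n] by force
      then show ?case using elim by (simp add: field_simps)
    qed
  next
    fix a assume "secrecy_capacity T W V < a"
    then show "\<forall>\<^sub>F n in sequentially. 1 / real n * M n < a"
      using upper by (intro eventually_sequentiallyI[of 1]) (force intro: le_less_trans)
  qed
  with Q show ?thesis by (intro exI[of _ M]) (auto simp: M_def)
qed

end
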